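(* Let $K$ be a field, let $M=(x,y,z)\subseteq K[x,y,z]$, and let $I\subseteq K[x,y,z]$ be the ideal of an almost collinear subscheme of $\mathbb{P}^2$ or of a nearly-complete intersection in $\mathbb{P}^2$. Then for every integer $r\geq 1$, $I^{(2r)}\subseteq M^rI^r$ and $I^{(2r-1)}\subseteq M^{r-1}I^r$.
   Context: $K$ is a field of arbitrary characteristic and $K[\mathbb{P}^2]=K[x,y,z]$. The ideal of a finite set of distinct points $q_1,\dots,q_s\in\mathbb{P}^2$ is $I=\bigcap_i I(q_i)$, where $I(q_i)$ is the ideal generated by all forms vanishing at $q_i$; its $m$-th symbolic power is $I^{(m)}=\bigcap_i I(q_i)^m$. An almost collinear subscheme of $n+1$ points ($n\geq 2$) is a set of distinct points $p_0,p_1,\dots,p_n\in\mathbb{P}^2$ such that $p_1,\dots,p_n$ lie on a line $L$ and $p_0\notin L$. A nearly-complete intersection of $2n+1$ points ($n\geq 1$) is a set of distinct points $p_0,p_1,\dots,p_{2n}\in\mathbb{P}^2$ for which there are two distinct lines $L_1,L_2$ such that $p_0$ is the point $L_1\cap L_2$, $p_1,\dots,p_n\in L_1\setminus L_2$ and $p_{n+1},\dots,p_{2n}\in L_2\setminus L_1$. *)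

theory Defs
  imports
    "HOL-Library.Poly_Mapping"
    "HOL-Library.Numeral_Type"
    "HOL-Analysis.Finite_Cartesian_Product"
    "HOL-Algebra.Ideal_Product"
    "HOL-Algebra.Algebraic_Closure_Type"
begin

text \<open>Elements of $K[x,y,z]$ are finitely supported functions from exponent vectors to $K$;
  the variables $x, y, z$ are indexed by the elements 0, 1, 2 of the three-element type 3.\<close>

type_synonym 'k poly3 = "(3 \<Rightarrow>\<^sub>0 nat) \<Rightarrow>\<^sub>0 'k"

abbreviation PR :: "('k::field) poly3 ring"
  where "PR \<equiv> ring_of_type_algebra"

definition pvar :: "3 \<Rightarrow> ('k::field) poly3"
  where "pvar i = Poly_Mapping.single (Poly_Mapping.single i 1) 1"

definition eval3 :: "('k::field) ^ 3 \<Rightarrow> 'k poly3 \<Rightarrow> 'k"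
  where "eval3 v f = (\<Sum>m\<in>Poly_Mapping.keys f.
           Poly_Mapping.lookup f m * (\<Prod>i\<in>UNIV. (v $ i) ^ Poly_Mapping.lookup m i))"

text \<open>The zero polynomial is a form of every degree.\<close>

definition is_form :: "nat \<Rightarrow> ('k::field) poly3 \<Rightarrow> bool"
  where "is_form d f \<longleftrightarrow>
           (\<forall>m\<in>Poly_Mapping.keys f. (\<Sum>i\<in>UNIV. Poly_Mapping.lookup m i) = d)"

text \<open>A point of $\mathbb{P}^2$ is the set of all its homogeneous coordinate vectors.\<close>

definition proj_rel :: "(('k::field) ^ 3) rel"
  where "proj_rel = {(v, w). v \<noteq> 0 \<and> w \<noteq> 0 \<and> (\<exists>c. c \<noteq> 0 \<and> w = c *s v)}"

definition proj_plane :: "(('k::field) ^ 3) set set"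
  where "proj_plane = {v. v \<noteq> 0} // proj_rel"

definition vanishes_at :: "('k::field) poly3 \<Rightarrow> ('k ^ 3) set \<Rightarrow> bool"
  where "vanishes_at f q \<longleftrightarrow> (\<forall>v\<in>q. eval3 v f = 0)"

definition proj_lines :: "(('k::field) ^ 3) set set set"
  where "proj_lines = {{q \<in> proj_plane. vanishes_at l q} | l. is_form 1 l \<and> l \<noteq> 0}"

definition irrelevant_ideal :: "('k::field) poly3 set"
  where "irrelevant_ideal = Idl\<^bsub>PR\<^esub> {pvar 0, pvar 1, pvar 2}"

definition point_ideal :: "(('k::field) ^ 3) set \<Rightarrow> 'k poly3 set"
  where "point_ideal q = Idl\<^bsub>PR\<^esub> {f. (\<exists>d. is_form d f) \<and> vanishes_at f q}"

text \<open>Powers are taken in the semiring of ideals, whose unit is the whole polynomial ring,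
  so the zeroth power of an ideal is the unit ideal.\<close>

definition ideal_power :: "('k::field) poly3 set \<Rightarrow> nat \<Rightarrow> 'k poly3 set"
  where "ideal_power I m = I [^]\<^bsub>ideals_set PR\<^esub> m"

definition points_ideal :: "(('k::field) ^ 3) set set \<Rightarrow> 'k poly3 set"
  where "points_ideal Z = (\<Inter>q\<in>Z. point_ideal q)"

text \<open>The symbolic power $I^{(m)}$ of the ideal $I$ of the finite point set \<open>Z\<close>.\<close>

definition symbolic_power :: "(('k::field) ^ 3) set set \<Rightarrow> nat \<Rightarrow> 'k poly3 set"
  where "symbolic_power Z m = (\<Inter>q\<in>Z. ideal_power (point_ideal q) m)"

definition almost_collinear :: "(('k::field) ^ 3) set set \<Rightarrow> bool"
  where "almost_collinear Z \<longleftrightarrow>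
    (\<exists>n p L. n \<ge> (2::nat) \<and> Z = p ` {0..n} \<and> inj_on p {0..n} \<and> Z \<subseteq> proj_plane \<and>
       L \<in> proj_lines \<and> (\<forall>i\<in>{1..n}. p i \<in> L) \<and> p 0 \<notin> L)"

definition nearly_complete_intersection :: "(('k::field) ^ 3) set set \<Rightarrow> bool"
  where "nearly_complete_intersection Z \<longleftrightarrow>
    (\<exists>n p L1 L2. n \<ge> (1::nat) \<and> Z = p ` {0..2*n} \<and> inj_on p {0..2*n} \<and> Z \<subseteq> proj_plane \<and>
       L1 \<in> proj_lines \<and> L2 \<in> proj_lines \<and> L1 \<noteq> L2 \<and> L1 \<inter> L2 = {p 0} \<and>
       (\<forall>i\<in>{1..n}. p i \<in> L1 - L2) \<and> (\<forall>i\<in>{n+1..2*n}. p i \<in> L2 - L1))"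

end

theory Submission
  imports Defs "HOL-Analysis.Cartesian_Space"
begin

text \<open>The inclusions are instances of $I^{(m)} \subseteq M^{m-r} I^r$ for $m \ge 2r-1$. For both kinds of
  configuration there are a prime $P$, the ideal of the special point $p_0$, and forms $A$, $B$ with
  $A \in M \setminus P$, $B \in P^2$, $AP \subseteq I$ and $B \in I$ such that $I^{(m)} \subseteq (A,B)^m \cap P^m$.

  For an almost collinear set, $A$ is the linear form of the line $L$ and $B$ is the product of the
  lines joining $p_0$ to the points $p_i$. For a nearly-complete intersection, $A$ is the product of the
  lines joining $p_i$ to $p_{n+i}$, and $B$ is the product of the linear forms of $L_1$ and $L_2$.

  Given such data the inclusion is formal (\<open>pair_power_Int_ideal_power_subset\<close>). Write an element
  of $(A,B)^m$ as a combination of the products $A^j B^{m-j}$ with $j < r$, plus $A^r g$. Since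
  $m - j \ge m - r + 1 \ge r$, the factor $B^r \in I^r$ splits off, and $A \in M$, $B \in M^2$ put the rest
  into $M^{j+2(m-j-r)} \subseteq M^{m-r}$; so these products are in $M^{m-r} I^r$; they are also in
  $P^{2(m-j)} \subseteq P^m$. If the element is in $P^m$, then so is $A^r g$, and then so is $g$ because
  $P^m$ is primary and $A \notin P$. Finally $A^r P^m = (AP)^r P^{m-r} \subseteq I^r M^{m-r}$.

  The inclusion $I^{(m)} \subseteq (A,B)^m$ rests on $(x,u)^m \cap (x,v)^m \subseteq (x,uv)^m$ under regularity
  assumptions (\<open>pair_power_Int\<close>). Points on a line $a$, each with a further line $l_i$ through it, have
  ideals $(a, l_i)$, so that the intersection of the $m$-th powers of these ideals lies in
  $(a, \prod_i l_i)^m$ (\<open>points_on_line_ideal_powers\<close>). In the second configuration this is applied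
  to $L_1$ and to $L_2$ with the same product $H$ of lines, and then $(H,a)^m \cap (H,b)^m \subseteq (H,ab)^m$.

  The regularity assumptions reduce to primality of linear forms and of ideals of points. Both are
  obtained over every field, finite ones included, by exhibiting the ideals as kernels of
  substitution endomorphisms of the polynomial ring (\<open>lin_form_dvd_prime\<close>, \<open>point_ideal_eq\<close>).\<close>

section \<open>Powers of an ideal with two generators\<close>

text \<open>The power $(a,b)^m$, with the recursion $(a,b)^{m+1} = a (a,b)^m + (b^{m+1})$ that drives
  the inductions below. In particular \<open>pair_power a b (Suc 0)\<close> is the ideal $(a,b)$.\<close>
primrec pair_power :: "'a::comm_ring_1 \<Rightarrow> 'a \<Rightarrow> nat \<Rightarrow> 'a set" where
  "pair_power a b 0 = UNIV"
| "pair_power a b (Suc m) = {a * g + b ^ Suc m * h | g h. g \<in> pair_power a b m}"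

lemma pair_power_SucI: "g \<in> pair_power a b m \<Longrightarrow> a * g + b ^ Suc m * h \<in> pair_power a b (Suc m)"
  by auto

lemma pair_power_SucE:
  assumes "f \<in> pair_power a b (Suc m)"
  obtains g h where "g \<in> pair_power a b m" "f = a * g + b ^ Suc m * h"
  using assms by auto

declare pair_power.simps(2) [simp del]

lemma pair_power_one: "pair_power a b (Suc 0) = {a * g + b * h | g h. True}"
  by (auto simp: pair_power.simps(2))

lemma pair_power_add: "f \<in> pair_power a b m \<Longrightarrow> g \<in> pair_power a b m \<Longrightarrow> f + g \<in> pair_power a b m"
proof (induction m arbitrary: f g)
  case (Suc m)
  obtain f1 f2 where f: "f1 \<in> pair_power a b m" "f = a * f1 + b ^ Suc m * f2"
    using Suc.prems(1) by (rule pair_power_SucE)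
  obtain g1 g2 where g: "g1 \<in> pair_power a b m" "g = a * g1 + b ^ Suc m * g2"
    using Suc.prems(2) by (rule pair_power_SucE)
  have "f + g = a * (f1 + g1) + b ^ Suc m * (f2 + g2)"
    by (simp add: f g algebra_simps)
  then show ?case using pair_power_SucI[OF Suc.IH[OF f(1) g(1)]] by metis
qed simp

lemma pair_power_mult: "f \<in> pair_power a b m \<Longrightarrow> c * f \<in> pair_power a b m"
proof (induction m arbitrary: f)
  case (Suc m)
  obtain f1 f2 where f: "f1 \<in> pair_power a b m" "f = a * f1 + b ^ Suc m * f2"
    using Suc.prems(1) by (rule pair_power_SucE)
  have "c * f = a * (c * f1) + b ^ Suc m * (c * f2)"
    by (simp add: f algebra_simps)
  then show ?case using pair_power_SucI[OF Suc.IH[OF f(1)]] by metis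
qed simp

lemma pair_power_mult_right: "f \<in> pair_power a b m \<Longrightarrow> f * c \<in> pair_power a b m"
  using pair_power_mult[of f a b m c] by (simp add: mult.commute)

lemma pair_power_diff: "f \<in> pair_power a b m \<Longrightarrow> g \<in> pair_power a b m \<Longrightarrow> f - g \<in> pair_power a b m"
  using pair_power_add[of f a b m "- 1 * g"] pair_power_mult[of g a b m "-1"] by simp

lemma pair_power_left: "f \<in> pair_power a b m \<Longrightarrow> a * f \<in> pair_power a b (Suc m)"
  using pair_power_SucI[of f a b m 0] by simp

lemma pair_power_right: "f \<in> pair_power a b m \<Longrightarrow> b * f \<in> pair_power a b (Suc m)"
proof (induction m arbitrary: f)
  case 0
  then show ?case using pair_power_SucI[of 0 a b 0 f] by simp
next
  case (Suc m)
  obtain f1 f2 where f: "f1 \<in> pair_power a b m" "f = a * f1 + b ^ Suc m * f2"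
    using Suc.prems(1) by (rule pair_power_SucE)
  have "b * f = a * (b * f1) + b ^ Suc (Suc m) * f2"
    by (simp add: f algebra_simps)
  then show ?case using pair_power_SucI[OF Suc.IH[OF f(1)]] by metis
qed

lemma pair_power_power_right: "b ^ m * h \<in> pair_power a b m"
proof (induction m)
  case (Suc m)
  then show ?case using pair_power_right[OF Suc] by (simp add: mult.assoc)
qed simp

lemma pair_power_commute_le: "f \<in> pair_power a b m \<Longrightarrow> f \<in> pair_power b a m"
proof (induction m arbitrary: f)
  case (Suc m)
  obtain f1 f2 where f: "f1 \<in> pair_power a b m" "f = a * f1 + b ^ Suc m * f2"
    using Suc.prems(1) by (rule pair_power_SucE)
  have 1: "a * f1 \<in> pair_power b a (Suc m)" by (rule pair_power_right[OF Suc.IH[OF f(1)]])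
  have "b ^ n * f2 \<in> pair_power b a n" for n
  proof (induction n)
    case (Suc n)
    then show ?case using pair_power_left[OF Suc] by (simp add: mult.assoc)
  qed simp
  then show ?case unfolding f using 1 pair_power_add by blast
qed simp

lemma pair_power_prod:
  assumes "f \<in> pair_power a b m" "g \<in> pair_power a b (Suc 0)"
  shows "f * g \<in> pair_power a b (Suc m)"
proof -
  obtain g1 g2 where g: "g = a * g1 + b * g2"
    using assms(2) by (auto simp: pair_power_one)
  have "f * g = a * (f * g1) + b * (f * g2)" by (simp add: g algebra_simps)
  then show ?thesis
    by (simp add: pair_power_add pair_power_left pair_power_right pair_power_mult_right assms(1))
qed

text \<open>From here on, regularity is spelled out elementwise: that \<open>b\<close> is a nonzerodivisor modulo \<open>a\<close> reads
  \<open>a dvd b * f \<Longrightarrow> a dvd f\<close>, and that \<open>u\<close> is a nonzerodivisor modulo $(a,b)$ reads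
  \<open>u * f \<in> pair_power a b (Suc 0) \<Longrightarrow> f \<in> pair_power a b (Suc 0)\<close>. The next lemma is the first step in
  showing that $(a,b)^{m+1} : a = (a,b)^m$ for a regular sequence.\<close>
lemma nzd_dvd_power:
  fixes a b :: "'a::comm_ring_1"
  assumes nzd: "\<And>f. a dvd b * f \<Longrightarrow> a dvd f" and "a dvd b ^ m * f"
  shows "a dvd f"
  using assms(2)
proof (induction m)
  case (Suc m)
  then have "a dvd b * (b ^ m * f)" by (simp add: mult.assoc)
  then show ?case using nzd Suc.IH by blast
qed simp

lemma pair_power_cancel:
  fixes a b :: "'a::idom"
  assumes "a \<noteq> 0" and nzd: "\<And>f. a dvd b * f \<Longrightarrow> a dvd f" and "a * g \<in> pair_power a b (Suc m)"
  shows "g \<in> pair_power a b m"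
proof -
  obtain h c where h: "h \<in> pair_power a b m" "a * g = a * h + b ^ Suc m * c"
    using assms(3) by (rule pair_power_SucE)
  have "b ^ Suc m * c = a * (g - h)" using h by (simp add: algebra_simps)
  then have "a dvd b ^ Suc m * c" by (metis dvd_triv_left)
  then have "a dvd c" using nzd_dvd_power[OF nzd] by blast
  then obtain c' where c: "c = a * c'" by (elim dvdE)
  have "a * g = a * (h + b ^ m * (b * c'))" using h(2) c by (simp add: algebra_simps)
  then have "g = h + b ^ m * (b * c')" using \<open>a \<noteq> 0\<close> by simp
  then show ?thesis using h(1) pair_power_add pair_power_power_right by metis
qed

text \<open>If \<open>u\<close> is a nonzerodivisor modulo $(a,b)$, then it is one modulo $(a,b^m)$. Membership
  of \<open>w\<close> in $(a,b^m)$ is expressed as \<open>a dvd w - b ^ m * h\<close> for some \<open>h\<close>.\<close>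
lemma nzd_mod_power:
  fixes a b u :: "'a::comm_ring_1"
  assumes nzd: "\<And>f. a dvd b * f \<Longrightarrow> a dvd f"
    and u: "\<And>f. u * f \<in> pair_power a b (Suc 0) \<Longrightarrow> f \<in> pair_power a b (Suc 0)"
    and "a dvd u * f - b ^ m * g"
  shows "\<exists>h. a dvd f - b ^ m * h"
  using assms(3)
proof (induction m arbitrary: f g)
  case 0
  then show ?case by (intro exI[of _ f]) simp
next
  case (Suc m)
  obtain c where c: "u * f - b ^ Suc m * g = a * c" using Suc.prems by (elim dvdE)
  have "u * f = a * c + b * (b ^ m * g)" using c by (simp add: algebra_simps)
  then have "u * f \<in> pair_power a b (Suc 0)" unfolding pair_power_one by blast
  then have "f \<in> pair_power a b (Suc 0)" by (rule u)
  then obtain f1 f2 where f: "f = a * f1 + b * f2" by (auto simp: pair_power_one)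
  have "b * (u * f2 - b ^ m * g) = a * (c - u * f1)"
    using c by (simp add: f algebra_simps)
  then have "a dvd u * f2 - b ^ m * g" by (metis nzd dvd_triv_left)
  from Suc.IH[OF this] obtain h where h: "a dvd f2 - b ^ m * h" ..
  have "f - b ^ Suc m * h = a * f1 + b * (f2 - b ^ m * h)" by (simp add: f algebra_simps)
  then show ?case using h by (metis dvd_add dvd_mult dvd_triv_left)
qed

text \<open>A nonzerodivisor modulo $(a,b)$ is a nonzerodivisor modulo every power of $(a,b)$; so the powers
  of a prime $(a,b)$ are primary.\<close>
lemma pair_power_primary:
  fixes a b u :: "'a::idom"
  assumes a: "a \<noteq> 0" and nzd: "\<And>f. a dvd b * f \<Longrightarrow> a dvd f"
    and u: "\<And>f. u * f \<in> pair_power a b (Suc 0) \<Longrightarrow> f \<in> pair_power a b (Suc 0)"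
    and "u * f \<in> pair_power a b m"
  shows "f \<in> pair_power a b m"
  using assms(4)
proof (induction m arbitrary: f)
  case (Suc m)
  obtain h c where h: "h \<in> pair_power a b m" "u * f = a * h + b ^ Suc m * c"
    using Suc.prems by (rule pair_power_SucE)
  have "a dvd u * f - b ^ Suc m * c" using h(2) by simp
  from nzd_mod_power[OF nzd u this] obtain d where d: "a dvd f - b ^ Suc m * d" by blast
  then obtain g where g: "f = a * g + b ^ Suc m * d" by (metis dvdE diff_eq_eq)
  have "a * (u * g) = u * f + b ^ Suc m * (- u * d)" by (simp add: g algebra_simps)
  then have "a * (u * g) \<in> pair_power a b (Suc m)"
    using Suc.prems pair_power_add pair_power_power_right by metis
  from pair_power_cancel[OF a nzd this] have "g \<in> pair_power a b m" by (rule Suc.IH)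
  then show ?case unfolding g by (rule pair_power_SucI)
qed simp

text \<open>$(x,u)^m \cap (x,v)^m \subseteq (x,uv)^m$. Modulo \<open>x\<close> an element of the intersection is divisible by
  $u^m$ and by $v^m$, hence by $(uv)^m$; what remains is \<open>x\<close> times an element of the intersection
  for \<open>m - 1\<close>.\<close>
lemma pair_power_Int:
  fixes x u v :: "'a::idom"
  assumes x: "x \<noteq> 0" and nu: "\<And>f. x dvd u * f \<Longrightarrow> x dvd f" and nv: "\<And>f. x dvd v * f \<Longrightarrow> x dvd f"
    and uv: "\<And>f. u * f \<in> pair_power x v (Suc 0) \<Longrightarrow> f \<in> pair_power x v (Suc 0)"
    and "f \<in> pair_power x u m" "f \<in> pair_power x v m"
  shows "f \<in> pair_power x (u * v) m"
  using assms(5,6)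
proof (induction m arbitrary: f)
  case (Suc m)
  obtain g a where g: "g \<in> pair_power x u m" "f = x * g + u ^ Suc m * a"
    using Suc.prems(1) by (rule pair_power_SucE)
  obtain h b where h: "h \<in> pair_power x v m" "f = x * h + v ^ Suc m * b"
    using Suc.prems(2) by (rule pair_power_SucE)
  have *: "\<exists>c. x dvd a - v ^ Suc m * c" if "x dvd u ^ n * a - v ^ Suc m * b" for n a b
    using that
  proof (induction n arbitrary: b)
    case 0
    then show ?case by auto
  next
    case (Suc n)
    then have "x dvd u * (u ^ n * a) - v ^ Suc m * b" by (simp add: mult.assoc)
    from nzd_mod_power[OF nv uv this] show ?case using Suc.IH by blast
  qed
  have "u ^ Suc m * a - v ^ Suc m * b = x * (h - g)" using g(2) h(2) by (simp add: algebra_simps)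
  then have "x dvd u ^ Suc m * a - v ^ Suc m * b" by (metis dvd_triv_left)
  then have "\<exists>c. x dvd a - v ^ Suc m * c" by (rule *)
  then obtain c a' where c: "a = x * a' + v ^ Suc m * c" by (metis dvdE diff_eq_eq)
  let ?g = "g + u ^ Suc m * a'"
  have f: "f = x * ?g + (u * v) ^ Suc m * c"
    by (simp add: g c algebra_simps power_mult_distrib)
  have "x * ?g = f - u ^ Suc m * (v ^ Suc m * c)" using f
    by (simp add: power_mult_distrib mult.assoc)
  then have 1: "x * ?g \<in> pair_power x u (Suc m)"
    using Suc.prems(1) by (metis pair_power_diff pair_power_power_right)
  have "x * ?g = f - v ^ Suc m * (u ^ Suc m * c)" using f
    by (simp add: power_mult_distrib algebra_simps)
  then have 2: "x * ?g \<in> pair_power x v (Suc m)"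
    using Suc.prems(2) by (metis pair_power_diff pair_power_power_right)
  have "?g \<in> pair_power x (u * v) m"
    by (intro Suc.IH pair_power_cancel[OF x nu 1] pair_power_cancel[OF x nv 2])
  then show ?case unfolding f by (rule pair_power_SucI)
qed simp

text \<open>A product of nonzerodivisors modulo \<open>J\<close> is a nonzerodivisor modulo \<open>J\<close>.\<close>
lemma nzd_prod:
  fixes u :: "'i \<Rightarrow> 'a::comm_ring_1"
  assumes "finite S" "\<And>i f. i \<in> S \<Longrightarrow> u i * f \<in> J \<Longrightarrow> f \<in> J" "prod u S * f \<in> J"
  shows "f \<in> J"
  using assms
proof (induction S arbitrary: f rule: finite_induct)
  case (insert i S)
  have "u i * (prod u S * f) \<in> J" using insert by (simp add: mult.assoc)
  then show ?case using insert by blast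
qed simp

lemma pair_power_INT:
  fixes x :: "'a::idom"
  assumes "finite S" "x \<noteq> 0" "\<And>i f. i \<in> S \<Longrightarrow> x dvd l i * f \<Longrightarrow> x dvd f"
    and "\<And>i j f. i \<in> S \<Longrightarrow> j \<in> S \<Longrightarrow> i \<noteq> j \<Longrightarrow> l i * f \<in> pair_power x (l j) (Suc 0) \<Longrightarrow> f
      \<in> pair_power x (l j) (Suc 0)"
    and "S \<noteq> {}" "\<And>i. i \<in> S \<Longrightarrow> f \<in> pair_power x (l i) m"
  shows "f \<in> pair_power x (prod l S) m"
  using assms(1,5,3,4,6)
proof (induction S rule: finite_ne_induct)
  case (insert j S)
  have "f \<in> pair_power x (prod l S * l j) m"
  proof (rule pair_power_Int)
    show "x dvd f" if "x dvd prod l S * f" for f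
      using nzd_prod[of S l "{f. x dvd f}"] insert that by blast
    show "f \<in> pair_power x (l j) (Suc 0)" if "prod l S * f \<in> pair_power x (l j) (Suc 0)" for f
    proof (rule nzd_prod[OF _ _ that])
      show "h \<in> pair_power x (l j) (Suc 0)" if "i \<in> S" "l i * h \<in> pair_power x (l j) (Suc 0)"
        for i h
        using insert.prems(2)[of i j h] insert.hyps that by blast
    qed (rule insert.hyps)
    show "f \<in> pair_power x (prod l S) m" by (rule insert.IH) (use insert.prems in blast)+
  qed (use insert.prems \<open>x \<noteq> 0\<close> in blast)+
  then show ?case using insert by (simp add: mult.commute)
qed simp

text \<open>Every element of $(a,b)^m$ is a combination of the $a^j b^{m-j}$ with \<open>j < r\<close> and of $a^r$. Here
  \<open>T\<close> stands for an ideal that contains the former.\<close>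
lemma pair_power_expand:
  fixes a b :: "'a::comm_ring_1"
  assumes add: "\<And>s t. s \<in> T \<Longrightarrow> t \<in> T \<Longrightarrow> s + t \<in> T" and mult: "\<And>s t. t \<in> T \<Longrightarrow> t * s \<in> T"
    and z: "0 \<in> T"
    and "r \<le> m" "\<And>j. j < r \<Longrightarrow> a ^ j * b ^ (m - j) \<in> T" "f \<in> pair_power a b m"
  shows "\<exists>g t. t \<in> T \<and> f = t + a ^ r * g \<and> g \<in> pair_power a b (m - r)"
  using assms(4,5)
proof (induction r)
  case 0
  then show ?case using assms(6) z by (intro exI[of _ f] exI[of _ 0]) simp
next
  case (Suc r)
  then obtain g t where g: "t \<in> T" "f = t + a ^ r * g" "g \<in> pair_power a b (Suc (m - Suc r))"
    by (auto simp: Suc_diff_Suc)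
  obtain h c where h: "h \<in> pair_power a b (m - Suc r)" "g = a * h + b ^ Suc (m - Suc r) * c"
    using g(3) by (rule pair_power_SucE)
  have "Suc (m - Suc r) = m - r" using Suc.prems by simp
  then have "f = (t + a ^ r * b ^ (m - r) * c) + a ^ Suc r * h"
    using g(2) h(2) by (simp add: algebra_simps)
  moreover have "t + a ^ r * b ^ (m - r) * c \<in> T"
    using Suc.prems(2)[of r] by (intro add[OF g(1) mult]) simp
  ultimately show ?case using h(1) by blast
qed

section \<open>Ideals of the polynomial ring and their powers\<close>

lemma PR_simps [simp]:
  "carrier PR = UNIV" "x \<otimes>\<^bsub>PR\<^esub> y = x * y" "x \<oplus>\<^bsub>PR\<^esub> y = x + y" "\<one>\<^bsub>PR\<^esub> = 1" "\<zero>\<^bsub>PR\<^esub> = 0"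
  by (simp_all add: ring_of_type_algebra_def)

interpretation PR: cring "PR :: ('k::field) poly3 ring"
  by (rule cring_from_type_algebra)

lemma PR_idealI:
  fixes J :: "('k::field) poly3 set"
  assumes "0 \<in> J" "\<And>f g. f \<in> J \<Longrightarrow> g \<in> J \<Longrightarrow> f + g \<in> J" "\<And>f g. f \<in> J \<Longrightarrow> g * f \<in> J"
  shows "ideal J PR"
proof (rule idealI)
  have inv: "\<ominus>\<^bsub>PR\<^esub> f = - f" for f :: "'k poly3"
    by (rule PR.minus_equality) auto
  show "subgroup J (add_monoid PR)"
  proof (rule PR.add.subgroupI)
    show "\<ominus>\<^bsub>PR\<^esub> f \<in> J" if "f \<in> J" for f
      using assms(3)[OF that, of "-1"] by (simp add: inv)
  qed (use assms in auto)
  show "f \<otimes>\<^bsub>PR\<^esub> x \<in> J" if "f \<in> J" for f x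
    using assms(3)[OF that, of x] by (simp add: mult.commute)
qed (use assms in \<open>auto intro: PR.ring_axioms\<close>)

context
  fixes J :: "('k::field) poly3 set" assumes J: "ideal J PR"
begin

lemma PR_ideal_zero: "0 \<in> J"
  using additive_subgroup.zero_closed[OF ideal.axioms(1)[OF J]] by simp

lemma PR_ideal_add: "f \<in> J \<Longrightarrow> g \<in> J \<Longrightarrow> f + g \<in> J"
  using additive_subgroup.a_closed[OF ideal.axioms(1)[OF J]] by simp

lemma PR_ideal_mult: "f \<in> J \<Longrightarrow> g * f \<in> J"
  using ideal.I_l_closed[OF J] by simp

lemma PR_ideal_mult_right: "f \<in> J \<Longrightarrow> f * g \<in> J"
  using ideal.I_r_closed[OF J] by simp

lemma PR_ideal_diff: "f \<in> J \<Longrightarrow> g \<in> J \<Longrightarrow> f - g \<in> J"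
  using PR_ideal_add[of f "-1 * g"] PR_ideal_mult[of g "-1"] by simp

lemma PR_ideal_sum: "(\<And>i. i \<in> S \<Longrightarrow> h i \<in> J) \<Longrightarrow> sum h S \<in> J"
  by (induction S rule: infinite_finite_induct) (auto simp: PR_ideal_zero intro: PR_ideal_add)

end

lemma ideal_power_0 [simp]: "ideal_power I 0 = UNIV"
  by (simp add: ideal_power_def ideals_set_def)

lemma ideal_power_Suc [simp]: "ideal_power I (Suc m) = ideal_power I m \<cdot>\<^bsub>PR\<^esub> I"
  by (simp add: ideal_power_def ideals_set_def)

lemma ideal_ideal_power:
  assumes "ideal (I :: ('k::field) poly3 set) PR"
  shows "ideal (ideal_power I m) PR"
proof (induction m)
  case 0
  then show ?case by (simp add: PR_idealI)
next
  case (Suc m)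
  then show ?case by (simp add: PR.ideal_prod_is_ideal assms)
qed

lemma ideal_power_add:
  assumes "ideal (I :: ('k::field) poly3 set) PR"
  shows "ideal_power I (m + n) = ideal_power I m \<cdot>\<^bsub>PR\<^esub> ideal_power I n"
proof -
  interpret S: comm_monoid "ideals_set (PR :: 'k poly3 ring)"
    by (rule PR.ideals_set_is_comm_monoid)
  have "I \<in> carrier (ideals_set PR)" using assms by (simp add: ideals_set_def)
  from S.nat_pow_mult[OF this, of m n] show ?thesis
    by (simp add: ideal_power_def ideals_set_def)
qed

lemma ideal_power_one:
  assumes "ideal (I :: ('k::field) poly3 set) PR"
  shows "ideal_power I (Suc 0) = I"
proof -
  interpret S: comm_monoid "ideals_set (PR :: 'k poly3 ring)"
    by (rule PR.ideals_set_is_comm_monoid)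
  have "I \<in> carrier (ideals_set PR)" using assms by (simp add: ideals_set_def)
  from S.nat_pow_eone[OF this] show ?thesis by (simp add: ideal_power_def)
qed

lemma ideal_power_mult:
  assumes "ideal (I :: ('k::field) poly3 set) PR" "f \<in> ideal_power I m" "g \<in> ideal_power I n"
  shows "f * g \<in> ideal_power I (m + n)"
  using ideal_prod.prod[of f "ideal_power I m" g "ideal_power I n" PR] assms
    by (simp add: ideal_power_add)

lemma ideal_power_antimono:
  assumes I: "ideal (I :: ('k::field) poly3 set) PR" and "m \<le> n"
  shows "ideal_power I n \<subseteq> ideal_power I m"
proof -
  have "ideal_power I (m + (n - m)) \<subseteq> ideal_power I m"
    unfolding ideal_power_add[OF I]
    using PR.ideal_prod_inter[OF ideal_ideal_power[OF I] ideal_ideal_power[OF I]] by blast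
  then show ?thesis using \<open>m \<le> n\<close> by simp
qed

lemma ideal_power_mono:
  assumes "(I :: ('k::field) poly3 set) \<subseteq> J" shows "ideal_power I n \<subseteq> ideal_power J n"
proof (induction n)
  case (Suc n)
  have "f \<in> ideal_power J n \<cdot>\<^bsub>PR\<^esub> J" if "f \<in> ideal_power I n \<cdot>\<^bsub>PR\<^esub> I" for f
    using that
  proof induction
    case (prod i j)
    then show ?case using assms Suc by (blast intro: ideal_prod.prod)
  qed (rule ideal_prod.sum)
  then show ?case by auto
qed simp

lemma power_in_ideal_power:
  assumes I: "ideal (I :: ('k::field) poly3 set) PR" "f \<in> ideal_power I c"
  shows "f ^ n \<in> ideal_power I (c * n)"
proof (induction n)
  case (Suc n)
  then show ?case using ideal_power_mult[OF I Suc] by (simp add: mult.commute)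
qed simp

text \<open>The ideal-theoretic heart of the argument: $(A,B)^m \cap P^m \subseteq M^{m-r} I^r$ for $m \ge 2r-1$.
  For \<open>j < r\<close> the products $A^j B^{m-j}$ already lie in $M^{m-r} I^r$, because $A \in M$ and $B \in I \cap M^2$, and
  also in $P^m$, because $B \in P^2$. Subtracting them from an element of the intersection leaves
  $A^r g \in P^m$. Then $g \in P^m$, and $A^r P^m = (AP)^r P^{m-r} \subseteq I^r M^{m-r}$.\<close>
lemma pair_power_Int_ideal_power_subset:
  fixes M I P :: "('k::field) poly3 set"
  assumes M: "ideal M PR" and I: "ideal I PR" and P: "ideal P PR"
    and A: "A \<in> M" and PM: "P \<subseteq> M" and B: "B \<in> ideal_power P 2" "B \<in> I"
    and AP: "\<And>p. p \<in> P \<Longrightarrow> A * p \<in> I"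
    and primary: "\<And>f. A * f \<in> ideal_power P m \<Longrightarrow> f \<in> ideal_power P m"
    and m: "2 * r \<le> Suc m" "r \<le> m" and f: "f \<in> pair_power A B m" "f \<in> ideal_power P m"
  shows "f \<in> ideal_power M (m - r) \<cdot>\<^bsub>PR\<^esub> ideal_power I r"
proof -
  define T where "T = ideal_power M (m - r) \<cdot>\<^bsub>PR\<^esub> ideal_power I r"
  have T: "ideal T PR" unfolding T_def by (intro PR.ideal_prod_is_ideal ideal_ideal_power M I)
  have Pm: "ideal (ideal_power P m) PR" by (rule ideal_ideal_power[OF P])
  have "A ^ j * B ^ (m - j) \<in> T \<inter> ideal_power P m" if "j < r" for j
  proof
    have "B ^ (m - j) \<in> ideal_power P (2 * (m - j))" using power_in_ideal_power[OF P B(1)] .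
    also have "\<dots> \<subseteq> ideal_power P m" using that m by (intro ideal_power_antimono[OF P]) simp
    finally show "A ^ j * B ^ (m - j) \<in> ideal_power P m" by (rule PR_ideal_mult[OF Pm])
    have BM: "B \<in> ideal_power M 2" using B(1) ideal_power_mono[OF PM] by blast
    have "A ^ j * B ^ (m - j - r) \<in> ideal_power M (1 * j + 2 * (m - j - r))"
      using A by (intro ideal_power_mult[OF M] power_in_ideal_power[OF M] BM)
        (simp add: ideal_power_one[OF M] del: ideal_power_Suc)
    also have "\<dots> \<subseteq> ideal_power M (m - r)" using that m by (intro ideal_power_antimono[OF M]) simp
    finally have 1: "A ^ j * B ^ (m - j - r) \<in> ideal_power M (m - r)" .
    have 2: "B ^ r \<in> ideal_power I r"
      using power_in_ideal_power[OF I, of B 1 r] B(2)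
        by (simp add: ideal_power_one[OF I] del: ideal_power_Suc)
    have "m - j = (m - j - r) + r" using that m by simp
    then have "A ^ j * B ^ (m - j) = A ^ j * B ^ (m - j - r) * B ^ r"
      by (metis power_add mult.assoc)
    then show "A ^ j * B ^ (m - j) \<in> T" unfolding T_def using ideal_prod.prod[OF 1 2, of PR]
      by (simp only: PR_simps)
  qed
  then have "\<exists>g t. t \<in> T \<inter> ideal_power P m \<and> f = t + A ^ r * g \<and> g \<in> pair_power A B (m - r)"
    by (intro pair_power_expand[OF _ _ _ m(2) _ f(1)])
      (auto intro: PR_ideal_add[OF T] PR_ideal_add[OF Pm] PR_ideal_mult_right[OF T]
        PR_ideal_mult_right[OF Pm]
        PR_ideal_zero[OF T] PR_ideal_zero[OF Pm])
  then obtain t g where t: "t \<in> T" "t \<in> ideal_power P m" "f = t + A ^ r * g" by blast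
  \<comment> \<open>The remaining multiple of \<open>A ^ r\<close>: cancel \<open>A\<close> modulo the primary ideal $P^m$.\<close>
  have "A ^ r * g \<in> ideal_power P m" using PR_ideal_diff[OF Pm f(2) t(2)] t(3) by simp
  moreover have "g \<in> ideal_power P m" if "A ^ n * g \<in> ideal_power P m" for n
    using that by (induction n) (auto simp: mult.assoc dest: primary)
  ultimately have "g \<in> ideal_power P m" by blast
  then have "g \<in> ideal_power P (m - r) \<cdot>\<^bsub>PR\<^esub> ideal_power P r"
    using m(2) by (simp flip: ideal_power_add[OF P])
  then have "A ^ r * g \<in> T"
  proof induction
    case (prod i j)
    have "A ^ n * j \<in> ideal_power I n" if "j \<in> ideal_power P n" for n j
      using that
    proof (induction n arbitrary: j)
      case (Suc n)
      from Suc.prems show ?case unfolding ideal_power_Suc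
      proof induction
        case (prod i j)
        have "A ^ Suc n * (i * j) = (A ^ n * i) * (A * j)" by (simp add: algebra_simps)
        moreover have "(A ^ n * i) * (A * j) \<in> ideal_power I n \<cdot>\<^bsub>PR\<^esub> I"
          using ideal_prod.prod[of "A ^ n * i" "ideal_power I n" "A * j" I PR] Suc.IH AP prod
            by simp
        ultimately show ?case by (simp only: PR_simps)
      next
        case (sum s t)
        then show ?case
          using ideal_prod.sum[of "A ^ Suc n * s" PR "ideal_power I n" I "A ^ Suc n * t"]
            by (simp add: algebra_simps)
      qed
    qed simp
    then have "i * (A ^ r * j) \<in> T"
      unfolding T_def
        using ideal_prod.prod[of i "ideal_power M (m - r)" "A ^ r * j" "ideal_power I r" PR] prod
          ideal_power_mono[OF PM, of "m - r"] by auto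
    then show ?case by (simp add: algebra_simps)
  next
    case (sum s t)
    then show ?case using PR_ideal_add[OF T] by (simp add: distrib_left)
  qed
  then show ?thesis unfolding t(3) T_def[symmetric] using PR_ideal_add[OF T t(1)] by blast
qed

lemma ideal_pair_power: "ideal (pair_power a b m) (PR :: ('k::field) poly3 ring)"
proof -
  have "0 \<in> pair_power a b m"
    by (induction m) (auto simp: pair_power.simps(2) intro!: exI[of _ 0])
  then show ?thesis by (intro PR_idealI pair_power_add pair_power_mult)
qed

text \<open>The recursively defined set is the power of the ideal $(a,b)$.\<close>
lemma ideal_power_pair_power: "ideal_power (pair_power a b (Suc 0)) m = pair_power a b m"
proof
  show "ideal_power (pair_power a b (Suc 0)) m \<subseteq> pair_power a b m"
  proof (induction m)
    case (Suc m)
    have "f \<in> pair_power a b (Suc m)" if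
      "f \<in> ideal_power (pair_power a b (Suc 0)) m \<cdot>\<^bsub>PR\<^esub> pair_power a b (Suc 0)" for f
      using that
    proof induction
      case (prod i j)
      then show ?case using Suc by (auto intro: pair_power_prod)
    qed (simp add: pair_power_add)
    then show ?case by auto
  qed simp
  have ab: "a \<in> ideal_power (pair_power a b (Suc 0)) 1"
    "b \<in> ideal_power (pair_power a b (Suc 0)) 1"
    using pair_power_left[of 1 a b 0] pair_power_right[of 1 a b 0]
      by (simp_all add: ideal_power_one[OF ideal_pair_power] del: ideal_power_Suc)
  have I: "ideal (ideal_power (pair_power a b (Suc 0)) m) PR" for m
    by (rule ideal_ideal_power[OF ideal_pair_power])
  show "pair_power a b m \<subseteq> ideal_power (pair_power a b (Suc 0)) m"
  proof (induction m)
    case (Suc m)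
    show ?case
    proof
      fix f assume "f \<in> pair_power a b (Suc m)"
      then obtain g h where g: "g \<in> pair_power a b m" "f = a * g + b ^ Suc m * h"
        by (rule pair_power_SucE)
      have "a * g \<in> ideal_power (pair_power a b (Suc 0)) (1 + m)"
        using g(1) Suc by (intro ideal_power_mult ideal_pair_power ab) auto
      moreover have "b ^ Suc m \<in> ideal_power (pair_power a b (Suc 0)) (1 * Suc m)"
        by (intro power_in_ideal_power ideal_pair_power ab)
      ultimately show "f \<in> ideal_power (pair_power a b (Suc 0)) (Suc m)"
        unfolding g(2)
          by (simp only: mult_1 plus_1_eq_Suc)
            (rule PR_ideal_add[OF I _ PR_ideal_mult_right[OF I]])
    qed
  qed simp
qed

section \<open>Substitution homomorphisms\<close>

abbreviation const_poly :: "'k::field \<Rightarrow> 'k poly3" where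
  "const_poly c \<equiv> Poly_Mapping.single 0 c"

text \<open>The value of the monomial with exponent vector \<open>m\<close> when the variables are replaced by \<open>s\<close>.\<close>
definition monomial_subst :: "(3 \<Rightarrow> ('k::field) poly3) \<Rightarrow> (3 \<Rightarrow>\<^sub>0 nat) \<Rightarrow> 'k poly3" where
  "monomial_subst s m = (\<Prod>i\<in>UNIV. s i ^ Poly_Mapping.lookup m i)"

text \<open>The endomorphism of $K[x,y,z]$ over $K$ that maps the variable with index \<open>i\<close> to \<open>s i\<close>.\<close>
definition subst3 :: "(3 \<Rightarrow> ('k::field) poly3) \<Rightarrow> 'k poly3 \<Rightarrow> 'k poly3" where
  "subst3 s f = (\<Sum>m\<in>Poly_Mapping.keys f. const_poly (Poly_Mapping.lookup f m) * monomial_subst s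
    m)"

lemma subst3_superset:
  assumes "finite S" "Poly_Mapping.keys f \<subseteq> S"
  shows "subst3 s f = (\<Sum>m\<in>S. const_poly (Poly_Mapping.lookup f m) * monomial_subst s m)"
  unfolding subst3_def by (rule sum.mono_neutral_left) (use assms in \<open>auto simp: in_keys_iff\<close>)

lemma subst3_single: "subst3 s (Poly_Mapping.single m c) = const_poly c * monomial_subst s m"
  by (subst subst3_superset[of "{m}"]) auto

lemma subst3_0 [simp]: "subst3 s 0 = 0"
  by (simp add: subst3_def)

lemma subst3_add: "subst3 s (f + g) = subst3 s f + subst3 s g"
proof -
  let ?S = "Poly_Mapping.keys f \<union> Poly_Mapping.keys g"
  have "finite ?S" by simp
  moreover have "Poly_Mapping.keys (f + g) \<subseteq> ?S" by (rule keys_add)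
  ultimately show ?thesis
    by (simp add: subst3_superset[of ?S] lookup_add single_add distrib_right sum.distrib)
qed

lemma subst3_sum: "subst3 s (sum h S) = (\<Sum>i\<in>S. subst3 s (h i))"
  by (induction S rule: infinite_finite_induct) (auto simp: subst3_add)

lemma poly3_sum_monomials:
  "(f :: ('k::field) poly3)
    = (\<Sum>m\<in>Poly_Mapping.keys f. Poly_Mapping.single m (Poly_Mapping.lookup f m))"
  by (rule poly_mapping_eqI)
    (auto simp: lookup_sum lookup_single when_def in_keys_iff if_distrib sum.delta cong: if_cong)

lemma monomial_subst_0 [simp]: "monomial_subst s 0 = 1"
  by (simp add: monomial_subst_def)

lemma monomial_subst_add: "monomial_subst s (m + n) = monomial_subst s m * monomial_subst s n"
  by (simp add: monomial_subst_def lookup_add power_add prod.distrib)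

lemma subst3_mult: "subst3 s (f * g) = subst3 s f * subst3 s (g :: ('k::field) poly3)"
proof -
  have "f * g = (\<Sum>m\<in>Poly_Mapping.keys f. \<Sum>n\<in>Poly_Mapping.keys g.
      Poly_Mapping.single m (Poly_Mapping.lookup f m) * Poly_Mapping.single n
        (Poly_Mapping.lookup g n))"
    unfolding sum_product[symmetric] by (simp flip: poly3_sum_monomials)
  then have "subst3 s (f * g) = (\<Sum>m\<in>Poly_Mapping.keys f. \<Sum>n\<in>Poly_Mapping.keys g.
      subst3 s (Poly_Mapping.single (m + n) (Poly_Mapping.lookup f m * Poly_Mapping.lookup g n)))"
    by (simp add: mult_single subst3_sum)
  also have "\<dots> = subst3 s f * subst3 s g"
    unfolding subst3_def[of s f] subst3_def[of s g] sum_product subst3_single monomial_subst_add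
    by (intro sum.cong refl) (simp add: algebra_simps flip: mult_single[of 0 _ 0, simplified])
  finally show ?thesis .
qed

lemma monomial_subst_single: "monomial_subst s (Poly_Mapping.single i 1) = s i"
proof -
  have "monomial_subst s (Poly_Mapping.single i 1) = (\<Prod>j\<in>UNIV. if j = i then s j else 1)"
    unfolding monomial_subst_def by (intro prod.cong) (auto simp: lookup_single when_def)
  then show ?thesis by simp
qed

lemma subst3_pvar: "subst3 s (pvar i) = s i"
  unfolding pvar_def subst3_single by (simp only: monomial_subst_single single_one mult_1)

lemma monomial_eq: "Poly_Mapping.single m (c :: 'k::field) = const_poly c * monomial_subst pvar m"
proof -
  have pw: "Poly_Mapping.single k (1::'k) ^ n = Poly_Mapping.single (\<Sum>_<n. k) 1"
    for k :: "3 \<Rightarrow>\<^sub>0 nat" and n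
    by (induction n) (auto simp: mult_single add.commute simp del: sum_constant)
  have "monomial_subst pvar m
    = (\<Prod>i\<in>UNIV. Poly_Mapping.single (\<Sum>_<Poly_Mapping.lookup m i. Poly_Mapping.single i 1)
      (1::'k))"
    by (simp only: monomial_subst_def pvar_def pw)
  also have "\<dots> = Poly_Mapping.single (\<Sum>i\<in>UNIV. \<Sum>_<Poly_Mapping.lookup m i. Poly_Mapping.single i
    1) (1::'k)"
  proof -
    have "(\<Prod>i\<in>S. Poly_Mapping.single (h i) (1::'k)) = Poly_Mapping.single (sum h S) 1"
      if "finite S" for S :: "3 set" and h :: "3 \<Rightarrow> 3 \<Rightarrow>\<^sub>0 nat"
      using that by (induction S) (auto simp: mult_single)
    then show ?thesis by simp
  qed
  also have "(\<Sum>i\<in>UNIV. \<Sum>_<Poly_Mapping.lookup m i. Poly_Mapping.single i 1) = m"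
  proof (rule poly_mapping_eqI)
    fix j
    show "Poly_Mapping.lookup (\<Sum>i\<in>UNIV. \<Sum>_<Poly_Mapping.lookup m i. Poly_Mapping.single i 1) j
      = Poly_Mapping.lookup m j"
      by (simp only: lookup_sum lookup_single when_def) (simp add: if_distrib cong: if_cong)
  qed
  finally show ?thesis by (simp add: mult_single)
qed

text \<open>Together with the next lemma this identifies prime ideals: an ideal that is mapped to 0 by a
  substitution \<open>s\<close> and contains the differences \<open>pvar i - s i\<close> is the kernel of \<open>s\<close>, and a kernel is prime
  because the polynomial ring is a domain.\<close>
lemma subst3_cong:
  fixes f :: "('k::field) poly3"
  assumes J: "ideal J PR" and s: "\<And>i. pvar i - s i \<in> J"
  shows "f - subst3 s f \<in> J"
proof -
  have dm: "a * b - c * d \<in> J" if "a - c \<in> J" "b - d \<in> J" for a b c d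
  proof -
    have "a * b - c * d = b * (a - c) + c * (b - d)" by (simp add: algebra_simps)
    then show ?thesis using that by (metis PR_ideal_add[OF J] PR_ideal_mult[OF J])
  qed
  have pw: "a ^ n - c ^ n \<in> J" if "a - c \<in> J" for a c n
    using that by (induction n) (auto intro: dm PR_ideal_zero[OF J])
  have "(\<Prod>i\<in>S. pvar i ^ m i) - (\<Prod>i\<in>S. s i ^ m i) \<in> J" for m S
    by (induction S rule: infinite_finite_induct) (auto intro: dm pw s PR_ideal_zero[OF J])
  then have ms: "monomial_subst pvar m - monomial_subst s m \<in> J" for m
    by (simp add: monomial_subst_def)
  have "f - subst3 s f
    = (\<Sum>m\<in>Poly_Mapping.keys f. const_poly (Poly_Mapping.lookup f m) * (monomial_subst pvar m -
      monomial_subst s m))"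
    by (subst (1) poly3_sum_monomials)
      (simp add: subst3_def monomial_eq[symmetric] right_diff_distrib sum_subtractf)
  then show ?thesis by (metis (no_types, lifting) PR_ideal_sum[OF J] PR_ideal_mult[OF J] ms)
qed

lemma subst3_kernel_prime:
  fixes f :: "('k::field) poly3"
  assumes "subst3 s (f * g) = 0" shows "subst3 s f = 0 \<or> subst3 s g = 0"
  using assms by (simp add: subst3_mult)

lemma subst3_kernel_ideal: "ideal {f. subst3 s f = 0} PR"
  by (rule PR_idealI) (auto simp: subst3_add subst3_mult)

section \<open>Linear forms\<close>

no_notation fps_nth (infixl \<open>$\<close> 75)

text \<open>The linear form $a_1 x_1 + a_2 x_2 + a_3 x_3$; the index 3 of the type \<open>3\<close> equals 0.\<close>
definition lin_form :: "('k::field) ^ 3 \<Rightarrow> 'k poly3" where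
  "lin_form a = (\<Sum>i\<in>UNIV. const_poly (a $ i) * pvar i)"

text \<open>The standard bilinear form, that is, the value of the linear form \<open>a\<close> at \<open>v\<close>.\<close>
definition dot :: "('k::field) ^ 3 \<Rightarrow> 'k ^ 3 \<Rightarrow> 'k" where
  "dot a v = (\<Sum>i\<in>UNIV. a $ i * v $ i)"

text \<open>The vector product. It is the line through two points, and the intersection point of two
  lines; it vanishes exactly on linearly dependent pairs.\<close>
definition cross :: "('k::field) ^ 3 \<Rightarrow> 'k ^ 3 \<Rightarrow> 'k ^ 3" where
  "cross a b = vector [a $ 2 * b $ 3 - a $ 3 * b $ 2, a $ 3 * b $ 1 - a $ 1 * b $ 3, a $ 1 * b $ 2
    - a $ 2 * b $ 1]"

lemma lin_form_alt:
  "lin_form a = (\<Sum>i\<in>UNIV. Poly_Mapping.single (Poly_Mapping.single i 1) (a $ i))"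
  by (simp add: lin_form_def pvar_def mult_single)

lemma single_1_inj: "Poly_Mapping.single i (1::nat) = Poly_Mapping.single j 1 \<longleftrightarrow> i = j"
  by (metis lookup_single_eq lookup_single_not_eq zero_neq_one)

lemma lookup_lin_form: "Poly_Mapping.lookup (lin_form a) (Poly_Mapping.single j 1) = a $ j"
  by (simp add: lin_form_alt lookup_sum lookup_single when_def single_1_inj[simplified] if_distrib
    cong: if_cong)

lemma lookup_lin_form_other:
  "(\<And>i. m \<noteq> Poly_Mapping.single i 1) \<Longrightarrow> Poly_Mapping.lookup (lin_form a) m = 0"
  by (force simp: lin_form_alt lookup_sum lookup_single when_def intro!: sum.neutral)

lemma keys_lin_form: "Poly_Mapping.keys (lin_form a) \<subseteq> range (\<lambda>i. Poly_Mapping.single i 1)"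
  by (metis in_keys_iff lookup_lin_form_other rangeI subsetI)

lemma sum_single_1: "(\<Sum>i\<in>UNIV. Poly_Mapping.lookup (Poly_Mapping.single j (1::nat)) (i::3)) = 1"
  by (simp add: lookup_single when_def)

lemma is_form_lin_form: "is_form 1 (lin_form a)"
  unfolding is_form_def using keys_lin_form[of a] sum_single_1
    by (metis (no_types, lifting) imageE subsetD)

lemma degree_one_monomial:
  assumes "(\<Sum>i\<in>UNIV. Poly_Mapping.lookup m (i::3)) = (1::nat)"
  obtains i where "m = Poly_Mapping.single i 1"
proof -
  obtain i where "Poly_Mapping.lookup m i = 1" "\<And>j. j \<noteq> i \<Longrightarrow> Poly_Mapping.lookup m j = 0"
    using assms by (subst (asm) sum_eq_1_iff) auto
  then have "m = Poly_Mapping.single i 1"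
    by (intro poly_mapping_eqI) (auto simp: lookup_single when_def)
  then show ?thesis by (rule that)
qed

lemma form_of_degree_one:
  assumes "is_form 1 (l :: ('k::field) poly3)" obtains a where "l = lin_form a"
proof -
  define a where "a = (\<chi> i. Poly_Mapping.lookup l (Poly_Mapping.single i 1))"
  have "Poly_Mapping.lookup l m = Poly_Mapping.lookup (lin_form a) m" for m
  proof (cases "\<exists>i. m = Poly_Mapping.single i 1")
    case True
    then show ?thesis by (auto simp: lookup_lin_form[simplified] a_def)
  next
    case False
    then have "m \<notin> Poly_Mapping.keys l" using assms degree_one_monomial unfolding is_form_def
      by metis
    then show ?thesis using False by (simp add: in_keys_iff lookup_lin_form_other)
  qed
  then have "l = lin_form a" by (rule poly_mapping_eqI)
  then show ?thesis by (rule that)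
qed

lemma lin_form_0_iff: "lin_form a = 0 \<longleftrightarrow> a = 0"
  by (metis lookup_lin_form lookup_zero vec_eq_iff zero_index poly_mapping_eqI
    lookup_lin_form_other)

lemma eval3_lin_form: "eval3 v (lin_form a) = dot a v"
proof -
  let ?S = "range (\<lambda>i::3. Poly_Mapping.single i (1::nat))"
  have p: "(\<Prod>i\<in>UNIV. (v $ i) ^ Poly_Mapping.lookup (Poly_Mapping.single j (1::nat)) i) = v $ j"
    for j
  proof -
    have "(\<Prod>i\<in>UNIV. (v $ i) ^ Poly_Mapping.lookup (Poly_Mapping.single j (1::nat)) i)
      = (\<Prod>i\<in>UNIV. if i = j then v $ i else 1)"
      by (intro prod.cong) (auto simp: lookup_single when_def)
    then show ?thesis by simp
  qed
  have "eval3 v (lin_form a)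
    = (\<Sum>m\<in>?S. Poly_Mapping.lookup (lin_form a) m * (\<Prod>i\<in>UNIV. (v $ i) ^ Poly_Mapping.lookup m i))"
    unfolding eval3_def
      by (rule sum.mono_neutral_left) (use keys_lin_form in \<open>auto simp: in_keys_iff\<close>)
  also have "\<dots> = dot a v"
    by (subst sum.reindex)
      (auto simp: inj_on_def single_1_inj[simplified] lookup_lin_form[simplified] p[simplified]
        dot_def)
  finally show ?thesis .
qed

lemma subst3_lin_form: "subst3 s (lin_form a) = (\<Sum>i\<in>UNIV. const_poly (a $ i) * s i)"
  by (simp add: lin_form_def subst3_sum subst3_mult subst3_pvar subst3_single[of s 0])

section \<open>Points of the projective plane and their ideals\<close>

text \<open>The point with homogeneous coordinates \<open>v\<close>.\<close>
definition proj_pt :: "('k::field) ^ 3 \<Rightarrow> ('k ^ 3) set" where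
  "proj_pt v = proj_rel `` {v}"

lemma mem_proj_pt: "w \<in> proj_pt v \<longleftrightarrow> v \<noteq> 0 \<and> (\<exists>c. c \<noteq> 0 \<and> w = c *s v)"
  by (auto simp: proj_pt_def proj_rel_def)

lemma proj_planeE:
  assumes "q \<in> proj_plane" obtains v where "v \<noteq> 0" "q = proj_pt v"
  using assms by (auto simp: proj_plane_def proj_pt_def quotient_def)

lemma proj_pt_eqI:
  assumes "v \<noteq> 0" "c \<noteq> 0" "w = c *s v" shows "proj_pt v = proj_pt (w :: ('k::field) ^ 3)"
proof (intro Set.set_eqI iffI)
  fix u assume "u \<in> proj_pt v"
  then obtain d where "d \<noteq> 0" "u = d *s v" by (auto simp: mem_proj_pt)
  then have "u = (d / c) *s w" "d / c \<noteq> 0" using assms by (simp_all add: vector_smult_assoc)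
  then show "u \<in> proj_pt w" using assms unfolding mem_proj_pt by (metis vector_mul_eq_0)
next
  fix u assume "u \<in> proj_pt w"
  then obtain d where "d \<noteq> 0" "u = d *s w" by (auto simp: mem_proj_pt)
  then have "u = (d * c) *s v" "d * c \<noteq> 0" using assms by (simp_all add: vector_smult_assoc)
  then show "u \<in> proj_pt v" using assms(1) unfolding mem_proj_pt by blast
qed

lemma eval3_scale:
  assumes "is_form d f" shows "eval3 (c *s v) f = c ^ d * eval3 v f"
proof -
  have "(\<Prod>i\<in>UNIV. ((c *s v) $ i) ^ Poly_Mapping.lookup m i)
    = c ^ d * (\<Prod>i\<in>UNIV. (v $ i) ^ Poly_Mapping.lookup m i)"
    if "m \<in> Poly_Mapping.keys f" for m
  proof -
    have "(\<Sum>i\<in>UNIV. Poly_Mapping.lookup m i) = d" using assms that by (simp add: is_form_def)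
    then show ?thesis by (simp add: power_mult_distrib prod.distrib flip: power_sum)
  qed
  then show ?thesis unfolding eval3_def sum_distrib_left
    by (intro sum.cong) (simp_all add: algebra_simps)
qed

lemma vanishes_at_proj_pt:
  assumes "v \<noteq> 0" "is_form d f" shows "vanishes_at f (proj_pt v) \<longleftrightarrow> eval3 v f = 0"
proof
  assume "vanishes_at f (proj_pt v)"
  moreover have "v \<in> proj_pt v" using assms(1) by (auto simp: mem_proj_pt intro!: exI[of _ 1])
  ultimately show "eval3 v f = 0" by (simp add: vanishes_at_def)
qed (auto simp: vanishes_at_def mem_proj_pt eval3_scale[OF assms(2)])

text \<open>The substitution that restricts a polynomial to the line in affine 3-space spanned by \<open>v\<close>, with the
  variable of index \<open>k\<close> as parameter; meaningful when \<open>v $ k \<noteq> 0\<close>. Its kernel is the ideal of the point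
  \<open>v\<close>. Over a finite field, evaluation at the coordinate vectors of the point would not suffice for
  polynomials that are not forms.\<close>
definition point_subst :: "('k::field) ^ 3 \<Rightarrow> 3 \<Rightarrow> 3 \<Rightarrow> 'k poly3" where
  "point_subst v k i = const_poly (v $ i / v $ k) * pvar k"

lemma pvar_nonzero: "pvar i \<noteq> (0 :: ('k::field) poly3)"
  by (metis pvar_def lookup_single_eq lookup_zero zero_neq_one)

lemma const_power: "const_poly (c :: 'k::field) ^ n = const_poly (c ^ n)"
  by (induction n) (auto simp: mult_single)

lemma const_prod: "(\<Prod>i\<in>S. const_poly (c i :: 'k::field)) = const_poly (\<Prod>i\<in>S. c i)"
  by (induction S rule: infinite_finite_induct) (auto simp: mult_single)

lemma const_sum: "(\<Sum>i\<in>S. const_poly (c i :: 'k::field)) = const_poly (\<Sum>i\<in>S. c i)"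
  by (induction S rule: infinite_finite_induct) (auto simp: single_add)

lemma point_subst_form:
  assumes "is_form d f" "(v :: ('k::field) ^ 3) $ k \<noteq> 0"
  shows "subst3 (point_subst v k) f = const_poly ((1 / v $ k) ^ d * eval3 v f) * pvar k ^ d"
proof -
  let ?w = "(1 / v $ k) *s v"
  have "monomial_subst (point_subst v k) m
    = const_poly (\<Prod>i\<in>UNIV. (?w $ i) ^ Poly_Mapping.lookup m i) * pvar k ^ d"
    if "m \<in> Poly_Mapping.keys f" for m
  proof -
    have "(\<Sum>i\<in>UNIV. Poly_Mapping.lookup m i) = d" using assms that by (simp add: is_form_def)
    then show ?thesis
      by (simp add: monomial_subst_def point_subst_def power_mult_distrib prod.distrib const_power
        const_prod flip: power_sum)
  qed
  then have "subst3 (point_subst v k) f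
    = (\<Sum>m\<in>Poly_Mapping.keys f. const_poly (Poly_Mapping.lookup f m * (\<Prod>i\<in>UNIV. (?w $ i) ^
      Poly_Mapping.lookup m i))) * pvar k ^ d"
    unfolding subst3_def sum_distrib_right
      by (intro sum.cong) (simp_all add: mult_single flip: mult.assoc)
  also have "\<dots> = const_poly (eval3 ?w f) * pvar k ^ d"
    by (simp only: const_sum eval3_def)
  finally show ?thesis by (simp only: eval3_scale[OF assms(1)])
qed

lemma point_subst_form_0:
  assumes "is_form d f" "(v :: ('k::field) ^ 3) $ k \<noteq> 0"
  shows "subst3 (point_subst v k) f = 0 \<longleftrightarrow> eval3 v f = 0"
proof -
  have "const_poly c = 0 \<longleftrightarrow> c = 0" for c :: 'k
    by (metis lookup_single_eq lookup_zero single_zero)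
  then show ?thesis using assms(2) by (simp add: point_subst_form[OF assms] pvar_nonzero)
qed

lemma cross_comp [simp]:
  "cross a b $ 1 = a $ 2 * b $ 3 - a $ 3 * b $ 2"
  "cross a b $ 2 = a $ 3 * b $ 1 - a $ 1 * b $ 3"
  "cross a b $ 3 = a $ 1 * b $ 2 - a $ 2 * b $ 1"
  by (simp_all add: cross_def)

lemma dot_3: "dot a v = a $ 1 * v $ 1 + a $ 2 * v $ 2 + a $ 3 * v $ 3"
  by (simp add: dot_def sum_3)

lemma lin_form_3:
  "lin_form a = const_poly (a $ 1) * pvar 1 + const_poly (a $ 2) * pvar 2 + const_poly (a $ 3)
    * pvar 3"
  by (simp only: lin_form_def sum_3)

lemma vec3_eq_iff: "(a :: 'k ^ 3) = b \<longleftrightarrow> a $ 1 = b $ 1 \<and> a $ 2 = b $ 2 \<and> a $ 3 = b $ 3"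
  by (simp only: vec_eq_iff forall_3)

lemma cross_self_dot: "dot (cross a b) a = 0" "dot (cross a b) b = 0" "dot a (cross a b) = 0"
  by (simp_all add: dot_3 algebra_simps)

lemma cross_0_swap:
  assumes "cross a b = (0 :: ('k::field) ^ 3)" shows "a $ i * b $ j = a $ j * b $ i"
proof -
  have "cross a b $ 1 = 0" "cross a b $ 2 = 0" "cross a b $ 3 = 0" using assms by simp_all
  then have "a $ 2 * b $ 3 = a $ 3 * b $ 2" "a $ 3 * b $ 1 = a $ 1 * b $ 3"
    "a $ 1 * b $ 2 = a $ 2 * b $ 1"
    by simp_all
  then show ?thesis using exhaust_3[of i] exhaust_3[of j] by auto
qed

lemma cross_nonzeroI:
  assumes "dot b w = 0" "dot a w \<noteq> 0" "b \<noteq> 0" shows "cross a b \<noteq> (0 :: ('k::field) ^ 3)"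
proof
  assume "cross a b = 0"
  have "b $ j = 0" for j
  proof -
    have "dot a w * b $ j = (\<Sum>i\<in>UNIV. a $ i * b $ j * w $ i)"
      unfolding dot_def sum_distrib_right by (intro sum.cong) (simp_all add: mult_ac)
    also have "\<dots> = (\<Sum>i\<in>UNIV. a $ j * b $ i * w $ i)"
      using cross_0_swap[OF \<open>cross a b = 0\<close>] by metis
    also have "\<dots> = a $ j * dot b w"
      unfolding dot_def sum_distrib_left by (intro sum.cong) (simp_all add: mult_ac)
    finally show ?thesis using assms by simp
  qed
  then show False using \<open>b \<noteq> 0\<close> by (simp add: vec_eq_iff)
qed

lemma cross_0_imp_proj_pt_eq:
  assumes "cross v w = 0" "v \<noteq> 0" "w \<noteq> 0" shows "proj_pt v = proj_pt (w :: ('k::field) ^ 3)"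
proof -
  obtain k where k: "v $ k \<noteq> 0" using \<open>v \<noteq> 0\<close> by (auto simp: vec_eq_iff)
  have w: "w = (w $ k / v $ k) *s v"
    using cross_0_swap[OF assms(1), of k] k by (simp add: vec_eq_iff field_simps)
  moreover have "w $ k / v $ k \<noteq> 0" using w \<open>w \<noteq> 0\<close> by force
  ultimately show ?thesis using proj_pt_eqI[OF \<open>v \<noteq> 0\<close>] by blast
qed

lemma point_ideal_ideal: "ideal (point_ideal q) (PR :: ('k::field) poly3 ring)"
  unfolding point_ideal_def by (rule PR.genideal_ideal) simp

lemma lin_form_in_point_ideal:
  assumes "v \<noteq> 0" "dot a v = 0" shows "lin_form a \<in> point_ideal (proj_pt v)"
proof -
  have "{f. (\<exists>d. is_form d f) \<and> vanishes_at f (proj_pt v)} \<subseteq> point_ideal (proj_pt v)"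
    unfolding point_ideal_def by (rule PR.genideal_self) simp
  moreover have "vanishes_at (lin_form a) (proj_pt v)"
    using vanishes_at_proj_pt[OF assms(1) is_form_lin_form] assms(2) by (simp add: eval3_lin_form)
  ultimately show ?thesis using is_form_lin_form by blast
qed

lemma point_ideal_kernel:
  assumes k: "v $ k \<noteq> 0"
  shows "point_ideal (proj_pt v) \<subseteq> {f. subst3 (point_subst v k) f = 0}"
proof -
  have "v \<noteq> 0" using k by auto
  then show ?thesis unfolding point_ideal_def
    by (intro PR.genideal_minimal subst3_kernel_ideal)
      (use k vanishes_at_proj_pt point_subst_form_0 in blast)
qed

text \<open>The linear forms $w_k x_i - w_i x_k$ with $w = a \times b$ are the components of
  $x \times (a \times b) = (x \cdot b)\, a - (x \cdot a)\, b$, so they lie in the ideal of \<open>a\<close> and \<open>b\<close>.\<close>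
lemma cross_minors_in_ideal:
  fixes a b :: "('k::field) ^ 3"
  shows "const_poly (cross a b $ k) * pvar i - const_poly (cross a b $ i) * pvar k
    \<in> pair_power (lin_form a) (lin_form b) (Suc 0)"
proof -
  let ?G = "pair_power (lin_form a) (lin_form b) (Suc 0)"
  let ?C = "const_poly :: 'k \<Rightarrow> 'k poly3"
  let ?D = "\<lambda>i k. ?C (cross a b $ k) * pvar i - ?C (cross a b $ i) * pvar k"
  have C: "?C (x * y) = ?C x * ?C y" "?C (x - y) = ?C x - ?C y" for x y
    by (simp_all add: mult_single single_diff)
  have neg: "?D k i \<in> ?G" if "?D i k \<in> ?G" for i k
    using pair_power_mult[OF that, of "-1"] by simp
  have "?D 2 1 = lin_form a * ?C (b $ 3) + lin_form b * - ?C (a $ 3)"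
       "?D 3 2 = lin_form a * ?C (b $ 1) + lin_form b * - ?C (a $ 1)"
       "?D 1 3 = lin_form a * ?C (b $ 2) + lin_form b * - ?C (a $ 2)"
    unfolding lin_form_3 cross_comp C by (simp_all add: algebra_simps)
  then have "?D 2 1 \<in> ?G" "?D 3 2 \<in> ?G" "?D 1 3 \<in> ?G" unfolding pair_power_one by blast+
  moreover have "?D 1 2 \<in> ?G" "?D 2 3 \<in> ?G" "?D 3 1 \<in> ?G"
    by (rule neg, fact)+
  moreover have "?D i i \<in> ?G" for i using PR_ideal_zero[OF ideal_pair_power] by simp
  \<comment> \<open>In the remaining case distinction only the pair of indices matters.\<close>
  moreover define Q where "Q i k \<longleftrightarrow> ?D i k \<in> ?G" for i k
  ultimately have Q: "Q 2 1" "Q 3 2" "Q 1 3" "Q 1 2" "Q 2 3" "Q 3 1" "Q i i" for i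
    by blast+
  have "Q i k" using exhaust_3[of i] exhaust_3[of k] Q by auto
  then show ?thesis unfolding Q_def .
qed

text \<open>Any two distinct lines through a point generate its ideal, and this ideal is the kernel of
  \<open>point_subst\<close>, hence prime.\<close>
lemma point_ideal_eq:
  assumes k: "v $ k \<noteq> 0" and a: "dot a v = 0" and b: "dot b v = 0"
    and ab: "cross a b \<noteq> (0 :: ('k::field) ^ 3)"
  shows "point_ideal (proj_pt v) = pair_power (lin_form a) (lin_form b) (Suc 0)"
    and "point_ideal (proj_pt v) = {f. subst3 (point_subst v k) f = 0}"
proof -
  let ?G = "pair_power (lin_form a) (lin_form b) (Suc 0)"
  define w where "w = cross a b"
  have "v \<noteq> 0" using k by auto
  have 1: "?G \<subseteq> point_ideal (proj_pt v)"
    unfolding pair_power_one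
      using lin_form_in_point_ideal[OF \<open>v \<noteq> 0\<close> a] lin_form_in_point_ideal[OF \<open>v \<noteq> 0\<close> b]
    by (auto intro: PR_ideal_add[OF point_ideal_ideal] PR_ideal_mult_right[OF point_ideal_ideal])
  have "cross v w = 0"
  proof -
    have e: "cross v w $ 1 = dot b v * a $ 1 - dot a v * b $ 1"
      "cross v w $ 2 = dot b v * a $ 2 - dot a v * b $ 2"
      "cross v w $ 3 = dot b v * a $ 3 - dot a v * b $ 3"
      by (simp_all add: w_def dot_3 algebra_simps)
    then show ?thesis unfolding vec3_eq_iff e a b by simp
  qed
  note vw = cross_0_swap[OF this]
  have wk: "w $ k \<noteq> 0"
  proof
    assume "w $ k = 0"
    then have "w $ i = 0" for i using vw[of k i] k by simp
    then show False using ab by (simp add: w_def vec_eq_iff)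
  qed
  have "v $ i / v $ k = w $ i / w $ k" for i using vw[of k i] k wk by (simp add: field_simps)
  then have s: "pvar i - point_subst v k i
    = const_poly (1 / w $ k) * (const_poly (w $ k) * pvar i - const_poly (w $ i) * pvar k)" for i
    using wk by (simp add: point_subst_def right_diff_distrib mult_single flip: mult.assoc)
  have "pvar i - point_subst v k i \<in> ?G" for i
    unfolding s w_def by (intro pair_power_mult cross_minors_in_ideal)
  then have "f - subst3 (point_subst v k) f \<in> ?G" for f by (rule subst3_cong[OF ideal_pair_power])
  from this have 2: "{f. subst3 (point_subst v k) f = 0} \<subseteq> ?G"
  proof (intro subsetI)
    fix f assume "f \<in> {f. subst3 (point_subst v k) f = 0}"
    then show "f \<in> ?G" using \<open>f - subst3 (point_subst v k) f \<in> ?G\<close> by simp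
  qed
  show "point_ideal (proj_pt v) = pair_power (lin_form a) (lin_form b) (Suc 0)"
    and "point_ideal (proj_pt v) = {f. subst3 (point_subst v k) f = 0}"
    using 1 2 point_ideal_kernel[OF k] by auto
qed

lemma two_lines_through_point:
  assumes "v \<noteq> (0 :: ('k::field) ^ 3)"
  obtains a b where "dot a v = 0" "dot b v = 0" "cross a b \<noteq> 0"
proof -
  consider "v $ 1 \<noteq> 0" | "v $ 2 \<noteq> 0" | "v $ 3 \<noteq> 0" using assms by (auto simp: vec3_eq_iff)
  then show ?thesis
  proof cases
    case 1
    then show ?thesis using that[of "vector [v $ 2, - v $ 1, 0]" "vector [v $ 3, 0, - v $ 1]"]
      by (simp add: dot_3 vec3_eq_iff)
  next
    case 2
    then show ?thesis using that[of "vector [v $ 2, - v $ 1, 0]" "vector [0, v $ 3, - v $ 2]"]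
      by (simp add: dot_3 vec3_eq_iff)
  next
    case 3
    then show ?thesis using that[of "vector [v $ 3, 0, - v $ 1]" "vector [0, v $ 3, - v $ 2]"]
      by (simp add: dot_3 vec3_eq_iff)
  qed
qed

lemma point_ideal_prime:
  assumes "v \<noteq> (0 :: ('k::field) ^ 3)" "f * g \<in> point_ideal (proj_pt v)"
    "f \<notin> point_ideal (proj_pt v)"
  shows "g \<in> point_ideal (proj_pt v)"
proof -
  obtain k where k: "v $ k \<noteq> 0" using assms(1) by (auto simp: vec_eq_iff)
  obtain a b where "dot a v = 0" "dot b v = 0" "cross a b \<noteq> 0"
    using two_lines_through_point[OF assms(1)] .
  from point_ideal_eq(2)[OF k this] show ?thesis using assms(2,3) subst3_kernel_prime by blast
qed

lemma lin_form_in_point_ideal_iff: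
  assumes "v \<noteq> (0 :: ('k::field) ^ 3)"
  shows "lin_form a \<in> point_ideal (proj_pt v) \<longleftrightarrow> dot a v = 0"
proof
  obtain k where k: "v $ k \<noteq> 0" using assms(1) by (auto simp: vec_eq_iff)
  assume "lin_form a \<in> point_ideal (proj_pt v)"
  then have "subst3 (point_subst v k) (lin_form a) = 0" using point_ideal_kernel[OF k] by blast
  then show "dot a v = 0" by (simp only: point_subst_form_0[OF is_form_lin_form k] eval3_lin_form)
qed (rule lin_form_in_point_ideal[OF assms])

lemma proj_pt_eq_if_ideal_le:
  assumes "v \<noteq> 0" "w \<noteq> (0 :: ('k::field) ^ 3)" "point_ideal (proj_pt v) \<subseteq> point_ideal (proj_pt w)"
  shows "proj_pt v = proj_pt w"
proof -
  have d: "dot (cross v e) w = 0" for e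
  proof -
    have "lin_form (cross v e) \<in> point_ideal (proj_pt v)"
      using lin_form_in_point_ideal_iff[OF assms(1)] cross_self_dot by blast
    then show ?thesis using assms lin_form_in_point_ideal_iff by blast
  qed
  have "cross v w = 0"
    using d[of "vector [1, 0, 0]"] d[of "vector [0, 1, 0]"] d[of "vector [0, 0, 1]"]
    by (simp add: vec3_eq_iff dot_3 algebra_simps)
  then show ?thesis using cross_0_imp_proj_pt_eq assms by blast
qed

text \<open>A nonzero linear form is a prime element: it generates the kernel of the substitution that
  eliminates one variable occurring in it.\<close>
lemma lin_form_dvd_prime:
  assumes "a \<noteq> (0 :: ('k::field) ^ 3)" "lin_form a dvd f * g" "\<not> lin_form a dvd f"
  shows "lin_form a dvd g"
proof -
  obtain k where k: "a $ k \<noteq> 0" using assms(1) by (auto simp: vec_eq_iff)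
  define s where "s i = (if i = k then pvar k - const_poly (1 / a $ k) * lin_form a else pvar i)"
    for i
  have J: "ideal {f. lin_form a dvd f} PR" by (rule PR_idealI) auto
  have "pvar i - s i \<in> {f. lin_form a dvd f}" for i by (auto simp: s_def)
  then have c: "lin_form a dvd f - subst3 s f" for f using subst3_cong[OF J] by blast
  have "subst3 s (lin_form a)
    = (\<Sum>i\<in>UNIV. const_poly (a $ i) * pvar i - (if i = k then lin_form a else 0))"
    unfolding subst3_lin_form
    by (intro sum.cong)
      (use k in \<open>auto simp: s_def right_diff_distrib mult_single simp flip: mult.assoc\<close>)
  also have "\<dots> = 0" by (simp add: sum_subtractf lin_form_def)
  finally have "subst3 s (lin_form a) = 0" .
  have z: "lin_form a dvd f \<longleftrightarrow> subst3 s f = 0" for f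
  proof
    assume "lin_form a dvd f"
    then show "subst3 s f = 0" using \<open>subst3 s (lin_form a) = 0\<close>
      by (auto simp: subst3_mult elim!: dvdE)
  next
    assume "subst3 s f = 0"
    then show "lin_form a dvd f" using c[of f] by simp
  qed
  show ?thesis using assms(2,3) subst3_kernel_prime unfolding z by blast
qed

text \<open>If \<open>a\<close> divided \<open>b\<close>, then \<open>b\<close> would vanish at each point \<open>cross a e\<close> of the line \<open>a\<close>.\<close>
lemma lin_form_not_dvd:
  assumes "cross a b \<noteq> (0 :: ('k::field) ^ 3)" shows "\<not> lin_form a dvd lin_form b"
proof
  assume dvd: "lin_form a dvd lin_form b"
  have "dot b (cross a e) = 0" for e
  proof (cases "cross a e = 0")
    case False
    have "lin_form a \<in> point_ideal (proj_pt (cross a e))"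
      using lin_form_in_point_ideal[OF False] cross_self_dot by blast
    then have "lin_form b \<in> point_ideal (proj_pt (cross a e))"
      using dvd by (auto elim!: dvdE intro: PR_ideal_mult_right[OF point_ideal_ideal])
    then show ?thesis using lin_form_in_point_ideal_iff[OF False] by blast
  qed (simp add: dot_def)
  from this[of "vector [1, 0, 0]"] this[of "vector [0, 1, 0]"] this[of "vector [0, 0, 1]"]
  have "cross a b = 0" by (simp add: vec3_eq_iff dot_3 algebra_simps)
  then show False using assms by simp
qed

lemma lin_form_regular:
  assumes "cross a b \<noteq> (0 :: ('k::field) ^ 3)" "lin_form a dvd lin_form b * f"
    shows "lin_form a dvd f"
proof -
  have "a \<noteq> 0" using assms(1) by (auto simp: vec3_eq_iff)
  then show ?thesis using lin_form_dvd_prime assms lin_form_not_dvd by blast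
qed

lemma lin_form_nonzero: "cross a b \<noteq> (0 :: ('k::field) ^ 3) \<Longrightarrow> lin_form a \<noteq> 0"
  by (auto simp: lin_form_0_iff vec3_eq_iff)

lemma point_ideal_eq_pair_power:
  assumes "v \<noteq> (0 :: ('k::field) ^ 3)" "dot a v = 0" "dot b v = 0" "cross a b \<noteq> 0"
  shows "point_ideal (proj_pt v) = pair_power (lin_form a) (lin_form b) (Suc 0)"
proof -
  obtain k where k: "v $ k \<noteq> 0" using assms(1) by (auto simp: vec_eq_iff)
  show ?thesis using point_ideal_eq(1)[OF k assms(2-)] .
qed

lemma point_ideal_primary:
  assumes v: "v \<noteq> (0 :: ('k::field) ^ 3)" and u: "u \<notin> point_ideal (proj_pt v)"
    and f: "u * f \<in> ideal_power (point_ideal (proj_pt v)) m"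
  shows "f \<in> ideal_power (point_ideal (proj_pt v)) m"
proof -
  obtain a b where ab: "dot a v = 0" "dot b v = 0" "cross a b \<noteq> 0"
    using two_lines_through_point[OF v] .
  note eq = point_ideal_eq_pair_power[OF v ab]
  show ?thesis
    unfolding eq ideal_power_pair_power
  proof (rule pair_power_primary)
    show "h \<in> pair_power (lin_form a) (lin_form b) (Suc 0)"
      if "u * h \<in> pair_power (lin_form a) (lin_form b) (Suc 0)" for h
      using point_ideal_prime[OF v _ u] that unfolding eq .
    show "u * f \<in> pair_power (lin_form a) (lin_form b) m" using f
      unfolding eq ideal_power_pair_power .
  qed (use lin_form_nonzero lin_form_regular ab in blast)+
qed

text \<open>Let distinct points $v_i$ lie on the line \<open>a\<close>, and choose through each of them a further line
  $l_i \neq a$. Then the intersection of the $m$-th powers of their ideals is contained in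
  $(a, \prod_i l_i)^m$.\<close>
lemma points_on_line_ideal_powers:
  fixes v l :: "'i \<Rightarrow> ('k::field) ^ 3"
  assumes S: "finite S" "S \<noteq> {}" and v: "\<And>i. i \<in> S \<Longrightarrow> v i \<noteq> 0" "\<And>i. i \<in> S \<Longrightarrow> dot a (v i) = 0"
    and l: "\<And>i. i \<in> S \<Longrightarrow> dot (l i) (v i) = 0" "\<And>i. i \<in> S \<Longrightarrow> cross a (l i) \<noteq> 0"
    and inj: "\<And>i j. i \<in> S \<Longrightarrow> j \<in> S \<Longrightarrow> i \<noteq> j \<Longrightarrow> proj_pt (v i) \<noteq> proj_pt (v j)"
    and f: "\<And>i. i \<in> S \<Longrightarrow> f \<in> ideal_power (point_ideal (proj_pt (v i))) m"
  shows "f \<in> pair_power (lin_form a) (\<Prod>i\<in>S. lin_form (l i)) m"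
proof (rule pair_power_INT)
  have eq: "point_ideal (proj_pt (v i)) = pair_power (lin_form a) (lin_form (l i)) (Suc 0)"
    if "i \<in> S" for i
    using point_ideal_eq_pair_power v l that by blast
  show "f \<in> pair_power (lin_form a) (lin_form (l i)) m" if "i \<in> S" for i
    using f[OF that] unfolding eq[OF that] ideal_power_pair_power .
  show "lin_form a \<noteq> 0" using S(2) l(2) lin_form_nonzero by blast
  show "lin_form a dvd h" if "i \<in> S" "lin_form a dvd lin_form (l i) * h" for i h
    using l(2) lin_form_regular that by blast
  show "h \<in> pair_power (lin_form a) (lin_form (l j)) (Suc 0)"
    if ij: "i \<in> S" "j \<in> S" "i \<noteq> j"
      and "lin_form (l i) * h \<in> pair_power (lin_form a) (lin_form (l j)) (Suc 0)" for i j h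
  proof -
    have "lin_form (l i) \<notin> point_ideal (proj_pt (v j))"
    proof
      assume "lin_form (l i) \<in> point_ideal (proj_pt (v j))"
      then have "point_ideal (proj_pt (v i)) \<subseteq> point_ideal (proj_pt (v j))"
        unfolding eq[OF ij(1)] pair_power_one using lin_form_in_point_ideal[OF v[OF ij(2)]]
        by (auto intro!: PR_ideal_add[OF point_ideal_ideal] PR_ideal_mult_right[OF
          point_ideal_ideal])
      then show False using proj_pt_eq_if_ideal_le[OF v(1)[OF ij(1)] v(1)[OF ij(2)]] inj[OF ij]
        by blast
    qed
    then show ?thesis using point_ideal_prime[OF v(1)[OF ij(2)]] that(4) unfolding eq[OF ij(2)]
      by blast
  qed
qed (use S in auto)

section \<open>The two configurations\<close>

lemma proj_linesE:
  assumes "L \<in> proj_lines"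
  obtains a where "a \<noteq> (0 :: ('k::field) ^ 3)" "\<And>v. v \<noteq> 0 \<Longrightarrow> proj_pt v \<in> L \<longleftrightarrow> dot a v = 0"
proof -
  obtain l where l: "L = {q \<in> proj_plane. vanishes_at l q}" "is_form 1 l" "l \<noteq> 0"
    using assms by (auto simp: proj_lines_def)
  obtain a where a: "l = lin_form a" using form_of_degree_one[OF l(2)] .
  have "proj_pt v \<in> proj_plane" if "v \<noteq> 0" for v :: "'k ^ 3"
    using that by (auto simp: proj_pt_def proj_plane_def intro: quotientI)
  then have "proj_pt v \<in> L \<longleftrightarrow> dot a v = 0" if "v \<noteq> 0" for v
    using that vanishes_at_proj_pt[OF that is_form_lin_form, of a]
      by (simp add: l(1) a eval3_lin_form)
  moreover have "a \<noteq> 0" using l(3) by (simp add: a lin_form_0_iff)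
  ultimately show ?thesis using that by blast
qed

lemma irrelevant_ideal_ideal: "ideal irrelevant_ideal PR"
  unfolding irrelevant_ideal_def by (rule PR.genideal_ideal) simp

lemma lin_form_in_irrelevant: "lin_form a \<in> irrelevant_ideal"
proof -
  have s: "{pvar 0, pvar 1, pvar 2} \<subseteq> (irrelevant_ideal :: 'a poly3 set)"
    unfolding irrelevant_ideal_def by (rule PR.genideal_self) simp
  have "pvar i \<in> (irrelevant_ideal :: 'a poly3 set)" for i
  proof -
    have "(3 :: 3) = 0" by simp
    then show ?thesis using s exhaust_3[of i] by (metis insert_subset)
  qed
  then show ?thesis unfolding lin_form_def
    by (intro PR_ideal_sum[OF irrelevant_ideal_ideal] PR_ideal_mult[OF irrelevant_ideal_ideal])
qed

lemma points_ideal_ideal: "ideal (points_ideal Z) (PR :: ('k::field) poly3 ring)"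
  unfolding points_ideal_def
  by (rule PR_idealI)
    (auto intro: PR_ideal_zero[OF point_ideal_ideal] PR_ideal_add[OF point_ideal_ideal]
      PR_ideal_mult[OF point_ideal_ideal])

lemma prod_in_ideal:
  assumes "ideal J (PR :: ('k::field) poly3 ring)" "finite S" "i \<in> S" "g i \<in> J"
  shows "prod g S \<in> J"
  using assms by (simp add: prod.remove[OF assms(2,3)] PR_ideal_mult_right)

lemma point_ideal_le_irrelevant:
  assumes "v \<noteq> (0 :: ('k::field) ^ 3)" shows "point_ideal (proj_pt v) \<subseteq> irrelevant_ideal"
proof -
  obtain a b where ab: "dot a v = 0" "dot b v = 0" "cross a b \<noteq> 0"
    using two_lines_through_point[OF assms] .
  show ?thesis unfolding point_ideal_eq_pair_power[OF assms ab] pair_power_one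
    by (auto intro!: PR_ideal_add[OF irrelevant_ideal_ideal] PR_ideal_mult_right[OF
      irrelevant_ideal_ideal] lin_form_in_irrelevant)
qed

lemma prod_notin_point_ideal:
  assumes "v \<noteq> (0 :: ('k::field) ^ 3)" "finite S" "\<And>i. i \<in> S \<Longrightarrow> dot (l i) v \<noteq> 0"
  shows "(\<Prod>i\<in>S. lin_form (l i)) \<notin> point_ideal (proj_pt v)"
  using assms(2,3)
proof (induction S rule: finite_induct)
  case empty
  obtain k where k: "v $ k \<noteq> 0" using assms(1) by (auto simp: vec_eq_iff)
  have "subst3 (point_subst v k) 1 = (1 :: 'k poly3)"
    using subst3_single[of "point_subst v k" 0 1] by simp
  then have "1 \<notin> point_ideal (proj_pt v)" using point_ideal_kernel[OF k] by auto
  then show ?case by simp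
next
  case (insert i S)
  have "lin_form (l i) \<notin> point_ideal (proj_pt v)"
    using insert.prems[of i] by (simp add: lin_form_in_point_ideal_iff[OF assms(1)])
  moreover have "(\<Prod>i\<in>S. lin_form (l i)) \<notin> point_ideal (proj_pt v)"
    by (rule insert.IH) (simp add: insert.prems)
  ultimately have "lin_form (l i) * (\<Prod>i\<in>S. lin_form (l i)) \<notin> point_ideal (proj_pt v)"
    using point_ideal_prime[OF assms(1), of "lin_form (l i)" "\<Prod>i\<in>S. lin_form (l i)"] by blast
  then show ?case by (simp only: prod.insert[OF insert.hyps] not_False_eq_True)
qed

text \<open>This is \<open>pair_power_Int_ideal_power_subset\<close> with $P = I(p_0)$, with the linear form \<open>a\<close> of the
  line $L$ as $A$, and with the product \<open>F\<close> of the lines $l_i$ through $p_0$ and $p_i$ as $B$. The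
  product lies in $P^2$ because $n \ge 2$.\<close>
lemma almost_collinear_symbolic_power:
  fixes Z :: "(('k::field) ^ 3) set set"
  assumes "almost_collinear Z" and m: "2 * r \<le> Suc m" "r \<le> m"
  shows "symbolic_power Z m
    \<subseteq> ideal_power irrelevant_ideal (m - r) \<cdot>\<^bsub>PR\<^esub> ideal_power (points_ideal Z) r"
proof
  fix f assume f: "f \<in> symbolic_power Z m"
  obtain n p L where n: "n \<ge> (2::nat)" and Z: "Z = p ` {0..n}" and inj: "inj_on p {0..n}"
    and ZP: "Z \<subseteq> proj_plane"
    and L: "L \<in> proj_lines" "\<forall>i\<in>{1..n}. p i \<in> L" "p 0 \<notin> L"
    using assms(1) unfolding almost_collinear_def by (elim exE conjE) (rule that)
  have "\<exists>v. v \<noteq> 0 \<and> p i = proj_pt v" if "i \<in> {0..n}" for i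
  proof -
    have "p i \<in> proj_plane" using ZP Z that by auto
    then show ?thesis by (rule proj_planeE) blast
  qed
  then obtain v where v: "\<And>i. i \<in> {0..n} \<Longrightarrow> v i \<noteq> 0" "\<And>i. i \<in> {0..n} \<Longrightarrow> p i = proj_pt (v i)"
    by metis
  obtain a where a: "a \<noteq> 0" "\<And>w. w \<noteq> 0 \<Longrightarrow> proj_pt w \<in> L \<longleftrightarrow> dot a w = 0"
    by (rule proj_linesE[OF L(1)]) (rule that)
  have av: "dot a (v i) = 0" if "i \<in> {1..n}" for i
    using a(2)[of "v i"] v[of i] bspec[OF L(2) that] that by auto
  have av0: "dot a (v 0) \<noteq> 0" using a(2)[of "v 0"] v[of 0] L(3) by auto
  have v0: "v 0 \<noteq> 0" using v(1)[of 0] by simp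
  have dist: "proj_pt (v i) \<noteq> proj_pt (v j)" if "i \<in> {0..n}" "j \<in> {0..n}" "i \<noteq> j" for i j
    using inj_onD[OF inj, of i j] v(2)[OF that(1)] v(2)[OF that(2)] that by auto
  define l where "l i = cross (v 0) (v i)" for i
  have l: "dot (l i) (v 0) = 0" "dot (l i) (v i) = 0" for i
    by (simp_all add: l_def cross_self_dot)
  have lnz: "l i \<noteq> 0" if "i \<in> {1..n}" for i
    using cross_0_imp_proj_pt_eq[of "v 0" "v i"] dist[of 0 i] v(1)[of 0] v(1)[of i] that
      by (auto simp: l_def)
  have al: "cross a (l i) \<noteq> 0" if "i \<in> {1..n}" for i
    by (rule cross_nonzeroI[OF l(1) av0 lnz[OF that]])
  define F where "F = (\<Prod>i\<in>{1..n}. lin_form (l i))"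
  have fi: "f \<in> ideal_power (point_ideal (proj_pt (v i))) m" if "i \<in> {0..n}" for i
  proof -
    have "p i \<in> Z" using Z that by blast
    then show ?thesis using f unfolding symbolic_power_def v(2)[OF that] by blast
  qed
  have fF: "f \<in> pair_power (lin_form a) F m" unfolding F_def
    by (rule points_on_line_ideal_powers[where v = v]) (use n v(1) av l al dist fi in auto)
  have P: "ideal (point_ideal (proj_pt (v 0))) PR" by (rule point_ideal_ideal)
  have lP: "lin_form (l i) \<in> point_ideal (proj_pt (v 0))" for i
    using lin_form_in_point_ideal[OF v0 l(1)] .
  show "f \<in> ideal_power irrelevant_ideal (m - r) \<cdot>\<^bsub>PR\<^esub> ideal_power (points_ideal Z) r"
  proof (rule pair_power_Int_ideal_power_subset[OF irrelevant_ideal_ideal points_ideal_ideal P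
    lin_form_in_irrelevant point_ideal_le_irrelevant[OF v0] _ _ _ _ m fF])
    show "F \<in> ideal_power (point_ideal (proj_pt (v 0))) 2"
    proof -
      have "lin_form (l 2) * (\<Prod>i\<in>{1..n}-{1}-{2}. lin_form (l i)) \<in> point_ideal (proj_pt (v 0))"
        by (rule PR_ideal_mult_right[OF P lP])
      moreover have "F = lin_form (l 1) * (lin_form (l 2) * (\<Prod>i\<in>{1..n}-{1}-{2}. lin_form (l i)))"
        unfolding F_def using n
          by (subst prod.remove[of _ 1], simp, simp, subst prod.remove[of _ 2]) auto
      ultimately show ?thesis
        using ideal_power_mult[OF P, of "lin_form (l 1)" "Suc 0" "lin_form (l 2)
          * (\<Prod>i\<in>{1..n}-{1}-{2}. lin_form (l i))" "Suc 0"] lP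
        by (simp add: ideal_power_one[OF P] numeral_2_eq_2 del: ideal_power_Suc)
    qed
    have Fi: "F \<in> point_ideal (proj_pt (v i))" if "i \<in> {0..n}" for i
    proof (cases "i = 0")
      case True
      then show ?thesis unfolding F_def using n lP
        by (intro prod_in_ideal[OF point_ideal_ideal, of _ 1]) auto
    next
      case False
      then show ?thesis unfolding F_def using that v(1)[OF that] l(2)
        by (intro prod_in_ideal[OF point_ideal_ideal, of _ i])
          (auto intro: lin_form_in_point_ideal)
    qed
    then show "F \<in> points_ideal Z" using v(2) by (auto simp: points_ideal_def Z)
    show "lin_form a * q \<in> points_ideal Z" if "q \<in> point_ideal (proj_pt (v 0))" for q
    proof -
      have "lin_form a * q \<in> point_ideal (p i)" if "i \<in> {0..n}" for i
      proof (cases "i = 0")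
        case True
        then show ?thesis using PR_ideal_mult[OF P \<open>q \<in> _\<close>] v(2)[of 0] by simp
      next
        case False
        then have "lin_form a \<in> point_ideal (proj_pt (v i))"
          using lin_form_in_point_ideal[OF v(1) av] that by auto
        then show ?thesis using PR_ideal_mult_right[OF point_ideal_ideal] v(2)[OF that] by simp
      qed
      then show ?thesis by (auto simp: points_ideal_def Z)
    qed
    show "g \<in> ideal_power (point_ideal (proj_pt (v 0))) m"
      if "lin_form a * g \<in> ideal_power (point_ideal (proj_pt (v 0))) m" for g
      using point_ideal_primary[OF v0 _ that] lin_form_in_point_ideal_iff[OF v0] av0 by blast
    show "f \<in> ideal_power (point_ideal (proj_pt (v 0))) m" using fi by simp
  qed
qed

text \<open>Let \<open>a\<close> and \<open>b\<close> be the linear forms of $L_1$ and $L_2$. The lemma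
  \<open>pair_power_Int_ideal_power_subset\<close> applies with $P = I(p_0) = (a,b)$ and $B = ab$; its $A$ is the
  product \<open>H\<close> of the lines $h_i$ through $p_i$ and $p_{n+i}$, none of which contains $p_0$.\<close>
lemma nearly_complete_intersection_symbolic_power:
  fixes Z :: "(('k::field) ^ 3) set set"
  assumes "nearly_complete_intersection Z" and m: "2 * r \<le> Suc m" "r \<le> m"
  shows "symbolic_power Z m
    \<subseteq> ideal_power irrelevant_ideal (m - r) \<cdot>\<^bsub>PR\<^esub> ideal_power (points_ideal Z) r"
proof
  fix f assume f: "f \<in> symbolic_power Z m"
  obtain n p L1 L2 where n: "n \<ge> (1::nat)" and Z: "Z = p ` {0..2*n}" and inj: "inj_on p {0..2*n}"
    and ZP: "Z \<subseteq> proj_plane"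
    and L: "L1 \<in> proj_lines" "L2 \<in> proj_lines" "L1 \<inter> L2 = {p 0}"
    and L1: "\<forall>i\<in>{1..n}. p i \<in> L1 - L2" and L2: "\<forall>i\<in>{n+1..2*n}. p i \<in> L2 - L1"
    using assms(1) unfolding nearly_complete_intersection_def by (elim exE conjE) (rule that)
  have "\<exists>v. v \<noteq> 0 \<and> p i = proj_pt v" if "i \<in> {0..2*n}" for i
  proof -
    have "p i \<in> proj_plane" using ZP Z that by auto
    then show ?thesis by (rule proj_planeE) blast
  qed
  then obtain v where v: "\<And>i. i \<in> {0..2*n} \<Longrightarrow> v i \<noteq> 0" "\<And>i. i \<in> {0..2*n} \<Longrightarrow> p i = proj_pt (v i)"
    by metis
  obtain a where a: "a \<noteq> 0" "\<And>w. w \<noteq> 0 \<Longrightarrow> proj_pt w \<in> L1 \<longleftrightarrow> dot a w = 0"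
    by (rule proj_linesE[OF L(1)]) (rule that)
  obtain b where b: "b \<noteq> 0" "\<And>w. w \<noteq> 0 \<Longrightarrow> proj_pt w \<in> L2 \<longleftrightarrow> dot b w = 0"
    by (rule proj_linesE[OF L(2)]) (rule that)
  have v0: "v 0 \<noteq> 0" using v(1)[of 0] by simp
  have ab0: "dot a (v 0) = 0" "dot b (v 0) = 0"
    using a(2)[OF v0] b(2)[OF v0] L(3) v(2)[of 0] by auto
  have ab1: "dot a (v i) = 0" "dot b (v i) \<noteq> 0" if "i \<in> {1..n}" for i
    using a(2)[of "v i"] b(2)[of "v i"] bspec[OF L1 that] v[of i] that by auto
  have ab2: "dot b (v (n + i)) = 0" "dot a (v (n + i)) \<noteq> 0" if "i \<in> {1..n}" for i
    using a(2)[of "v (n + i)"] b(2)[of "v (n + i)"] bspec[OF L2, of "n + i"] v[of "n + i"] that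
      by auto
  have dist: "proj_pt (v i) \<noteq> proj_pt (v j)" if "i \<in> {0..2*n}" "j \<in> {0..2*n}" "i \<noteq> j" for i j
    using inj_onD[OF inj, of i j] v(2)[OF that(1)] v(2)[OF that(2)] that by auto
  define h where "h i = cross (v i) (v (n + i))" for i
  have h: "dot (h i) (v i) = 0" "dot (h i) (v (n + i)) = 0" for i
    by (simp_all add: h_def cross_self_dot)
  have hnz: "h i \<noteq> 0" if "i \<in> {1..n}" for i
    using cross_0_imp_proj_pt_eq[of "v i" "v (n + i)"] dist[of i "n + i"] v(1)[of i]
      v(1)[of "n + i"] that by (auto simp: h_def)
  have ah: "cross a (h i) \<noteq> 0" if "i \<in> {1..n}" for i
    by (rule cross_nonzeroI[OF h(2) ab2(2)[OF that] hnz[OF that]])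
  have bh: "cross b (h i) \<noteq> 0" if "i \<in> {1..n}" for i
    by (rule cross_nonzeroI[OF h(1) ab1(2)[OF that] hnz[OF that]])
  have h0: "dot (h i) (v 0) \<noteq> 0" if i: "i \<in> {1..n}" for i
  proof
    assume "dot (h i) (v 0) = 0"
    have vi: "v i \<noteq> 0" "i \<in> {0..2*n}" using v(1) i by auto
    have "point_ideal (proj_pt (v i)) = pair_power (lin_form a) (lin_form (h i)) (Suc 0)"
      by (rule point_ideal_eq_pair_power[OF vi(1) ab1(1)[OF i] h(1) ah[OF i]])
    also have "\<dots> = point_ideal (proj_pt (v 0))"
      by (rule point_ideal_eq_pair_power[OF v0 ab0(1) \<open>dot (h i) (v 0) = 0\<close> ah[OF i], symmetric])
    finally show False using proj_pt_eq_if_ideal_le[OF vi(1) v0] dist[OF vi(2), of 0] i by auto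
  qed
  \<comment> \<open>The point $p_1$ exists because $n \ge 1$; it lies on \<open>a\<close> but not on \<open>b\<close>.\<close>
  have ba: "cross b a \<noteq> 0" using cross_nonzeroI[of a "v 1" b] ab1[of 1] n a(1) by simp
  define H where "H = (\<Prod>i\<in>{1..n}. lin_form (h i))"
  have fi: "f \<in> ideal_power (point_ideal (proj_pt (v i))) m" if "i \<in> {0..2*n}" for i
  proof -
    have "p i \<in> Z" using Z that by blast
    then show ?thesis using f unfolding symbolic_power_def v(2)[OF that] by blast
  qed
  have faH: "f \<in> pair_power (lin_form a) H m" unfolding H_def
    by (rule points_on_line_ideal_powers[where v = v]) (use n v(1) ab1 h ah dist fi in auto)
  have fbH: "f \<in> pair_power (lin_form b) H m" unfolding H_def
    by (rule points_on_line_ideal_powers[where v = "\<lambda>i. v (n + i)"])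
      (use n v(1) ab2 h bh dist fi in auto)
  let ?P = "point_ideal (proj_pt (v 0))"
  have P: "ideal ?P PR" by (rule point_ideal_ideal)
  have HP: "H \<notin> ?P" unfolding H_def by (rule prod_notin_point_ideal[OF v0]) (use h0 in auto)
  have aP: "lin_form a \<in> ?P" and bP: "lin_form b \<in> ?P" using lin_form_in_point_ideal[OF v0] ab0
    by auto
  have Peq: "?P = pair_power (lin_form b) (lin_form a) (Suc 0)"
    by (rule point_ideal_eq_pair_power[OF v0 ab0(2) ab0(1) ba])
  have Hnz: "H \<noteq> 0" using HP PR_ideal_zero[OF P] by auto
  have dvd_H: "lin_form c dvd g" if c: "\<And>i. i \<in> {1..n} \<Longrightarrow> cross c (h i) \<noteq> 0"
    and "lin_form c dvd H * g" for c g
  proof -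
    have "g \<in> {g. lin_form c dvd g}"
    proof (rule nzd_prod[of "{1..n}" "\<lambda>i. lin_form (h i)"])
      show "k \<in> {g. lin_form c dvd g}" if "i \<in> {1..n}"
        "lin_form (h i) * k \<in> {g. lin_form c dvd g}" for i k
        using that(2) unfolding mem_Collect_eq by (rule lin_form_regular[OF c[OF that(1)]])
    qed (use that(2) in \<open>simp_all add: H_def\<close>)
    then show ?thesis by simp
  qed
  have H_dvd: "H dvd g" if c: "\<And>i. i \<in> {1..n} \<Longrightarrow> cross c (h i) \<noteq> 0"
    and "lin_form c \<noteq> 0" "H dvd lin_form c * g" for c g
  proof -
    obtain e where e: "lin_form c * g = H * e" using \<open>H dvd lin_form c * g\<close> by (elim dvdE)
    have "lin_form c dvd H * e" unfolding e[symmetric] by simp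
    from dvd_H[OF _ this] have "lin_form c dvd e" using c by blast
    then obtain e' where "e = lin_form c * e'" by (elim dvdE)
    then have "lin_form c * g = lin_form c * (H * e')" using e by (simp add: algebra_simps)
    then show ?thesis using \<open>lin_form c \<noteq> 0\<close> by simp
  qed
  \<comment> \<open>Intersecting $(H,a)^m$ and $(H,b)^m$ requires regularity in the other order, modulo \<open>H\<close>.\<close>
  have fHab: "f \<in> pair_power H (lin_form a * lin_form b) m"
  proof (rule pair_power_Int[OF Hnz])
    show "H dvd g" if "H dvd lin_form a * g" for g
      by (rule H_dvd[OF _ _ that]) (use ah a(1) in \<open>simp_all add: lin_form_0_iff\<close>)
    show "H dvd g" if "H dvd lin_form b * g" for g
      by (rule H_dvd[OF _ _ that]) (use bh b(1) in \<open>simp_all add: lin_form_0_iff\<close>)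
    show "g \<in> pair_power H (lin_form b) (Suc 0)"
      if "lin_form a * g \<in> pair_power H (lin_form b) (Suc 0)" for g
    proof -
      obtain s t where st: "lin_form a * g = H * s + lin_form b * t" using \<open>lin_form a * g \<in> _\<close>
        by (auto simp: pair_power_one)
      \<comment> \<open>Since \<open>H\<close> lies outside the prime $P$, the cofactor \<open>s\<close> lies in $P$.\<close>
      then have "H * s = lin_form a * g - lin_form b * t" by simp
      then have "H * s \<in> ?P"
        using PR_ideal_diff[OF P PR_ideal_mult_right[OF P aP] PR_ideal_mult_right[OF P bP]]
          by metis
      then have "s \<in> ?P" using point_ideal_prime[OF v0 _ HP] by blast
      then obtain s1 s2 where s: "s = lin_form b * s1 + lin_form a * s2" unfolding Peq
        by (auto simp: pair_power_one)
      have "lin_form a * (g - H * s2) = lin_form b * (t + H * s1)" using st s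
        by (simp add: algebra_simps)
      then have "lin_form b dvd g - H * s2" using lin_form_regular[OF ba] by (metis dvd_triv_left)
      then obtain u where "g - H * s2 = lin_form b * u" by (elim dvdE)
      then have "g = H * s2 + lin_form b * u" by (simp add: algebra_simps)
      then show ?thesis unfolding pair_power_one by blast
    qed
  qed (use faH fbH pair_power_commute_le in blast)+
  show "f \<in> ideal_power irrelevant_ideal (m - r) \<cdot>\<^bsub>PR\<^esub> ideal_power (points_ideal Z) r"
  proof (rule pair_power_Int_ideal_power_subset[OF irrelevant_ideal_ideal points_ideal_ideal P _
    point_ideal_le_irrelevant[OF v0] _ _ _ _ m fHab])
    show "H \<in> irrelevant_ideal" unfolding H_def
      by (rule prod_in_ideal[OF irrelevant_ideal_ideal, of _ 1])
        (use n lin_form_in_irrelevant in auto)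
    show "lin_form a * lin_form b \<in> ideal_power ?P 2"
      using ideal_power_mult[OF P, of "lin_form a" "Suc 0" "lin_form b" "Suc 0"] aP bP
      by (simp add: ideal_power_one[OF P] numeral_2_eq_2 del: ideal_power_Suc)
    have cases3: "i = 0 \<or> i \<in> {1..n} \<or> (\<exists>j\<in>{1..n}. i = n + j)" if "i \<in> {0..2*n}" for i
    proof -
      have "i = n + (i - n) \<and> i - n \<in> {1..n}" if "i > n" using that \<open>i \<in> _\<close> by auto
      then show ?thesis using that by (cases "i > n") (auto intro!: bexI[of _ "i - n"])
    qed
    have "lin_form a * lin_form b \<in> point_ideal (proj_pt (v i))" if i: "i \<in> {0..2*n}" for i
    proof -
      have "dot a (v i) = 0 \<or> dot b (v i) = 0" using cases3[OF i] ab0 ab1 ab2 by auto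
      then show ?thesis using lin_form_in_point_ideal[OF v(1)[OF i]]
        by (auto intro: PR_ideal_mult[OF point_ideal_ideal] PR_ideal_mult_right[OF
          point_ideal_ideal])
    qed
    then show "lin_form a * lin_form b \<in> points_ideal Z" using v(2)
      by (auto simp: points_ideal_def Z)
    show "H * q \<in> points_ideal Z" if q: "q \<in> ?P" for q
    proof -
      have "H * q \<in> point_ideal (proj_pt (v i))" if i: "i \<in> {0..2*n}" for i
      proof (cases "i = 0")
        case True
        then show ?thesis using PR_ideal_mult[OF P q] by simp
      next
        case False
        then have "\<exists>j\<in>{1..n}. i = j \<or> i = n + j" using cases3[OF i] by auto
        then obtain j where j: "j \<in> {1..n}" "dot (h j) (v i) = 0" using h by metis
        have "H \<in> point_ideal (proj_pt (v i))" unfolding H_def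
          by (rule prod_in_ideal[OF point_ideal_ideal _ j(1)])
            (use j(2) lin_form_in_point_ideal[OF v(1)[OF i]] in auto)
        then show ?thesis by (rule PR_ideal_mult_right[OF point_ideal_ideal])
      qed
      then show ?thesis using v(2) by (auto simp: points_ideal_def Z)
    qed
    show "g \<in> ideal_power ?P m" if "H * g \<in> ideal_power ?P m" for g
      using point_ideal_primary[OF v0 HP that] .
    show "f \<in> ideal_power ?P m" using fi by simp
  qed
qed

theorem theorem3p11:
  fixes Z :: "(('k::field) ^ 3) set set" and r :: nat
  assumes "almost_collinear Z \<or> nearly_complete_intersection Z"
    and "r \<ge> 1"
  shows "symbolic_power Z (2 * r) \<subseteq>
           ideal_power irrelevant_ideal r \<cdot>\<^bsub>PR\<^esub> ideal_power (points_ideal Z) r \<and>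
         symbolic_power Z (2 * r - 1) \<subseteq>
           ideal_power irrelevant_ideal (r - 1) \<cdot>\<^bsub>PR\<^esub> ideal_power (points_ideal Z) r"
proof -
  \<comment> \<open>Both inclusions are the case $m = 2r$ or $m = 2r-1$ of one statement, valid for $m \ge 2r-1$.\<close>
  have *: "symbolic_power Z m
    \<subseteq> ideal_power irrelevant_ideal (m - r) \<cdot>\<^bsub>PR\<^esub> ideal_power (points_ideal Z) r"
    if "2 * r \<le> Suc m" "r \<le> m" for m
    using assms(1) almost_collinear_symbolic_power nearly_complete_intersection_symbolic_power
      that by blast
  have "2 * r - r = r" "2 * r - 1 - r = r - 1" by simp_all
  then show ?thesis using *[of "2 * r"] *[of "2 * r - 1"] assms(2) by simp
qed

end
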